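(* Let $R$ be a commutative ring with unit, $A$ a finitely generated $R$-algebra, and $F\colon A\to A$ an endomorphism of $R$-algebras. Let $f$ denote the map induced by $F$ either on $\mathrm{Id}(A)$ or on $\operatorname{Spec}A$, namely $f(\mathfrak A)=F^{-1}(\mathfrak A)$. Then $h_{\mathrm{top}}(f)=0$, where these spaces are endowed with the constructible topology or with the Zariski topology.
   Context: $\mathrm{Id}(A)$ is the set of proper ideals of $A$. Viewing an ideal as its characteristic function, $\mathrm{Id}(A)\subset\{0,1\}^A$ and $\operatorname{Spec}A\subset\mathrm{Id}(A)$; the constructible topology is induced by the product topology, and is generated by sets $\{\mathfrak A: f_1,\dots,f_m\in\mathfrak A,\ g_1,\dots,g_n\notin\mathfrak A\}$. The Zariski topology on $\mathrm{Id}(A)$ is generated by the sets $\{\mathfrak A: g\notin\mathfrak A\}$, $g\in A$ (on $\operatorname{Spec}A$ it is the usual Zariski topology). Topological entropy of a continuous map $g$ of a quasi-compact space is $\sup_{\mathfrak U}\lim_n\frac1n\log N(\mathfrak U\vee g^{-1}\mathfrak U\vee\dots\vee g^{-(n-1)}\mathfrak U)$ over finite open covers, $N$ the minimal subcover size. *)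

theory Defs
  imports "HOL-Analysis.Analysis" "HOL-Algebra.Algebra"
begin

definition open_fin_cover :: "'b topology \<Rightarrow> 'b set set \<Rightarrow> bool" where
  "open_fin_cover T U \<longleftrightarrow> finite U \<and> (\<forall>u\<in>U. openin T u) \<and> topspace T \<subseteq> (Union U)"

definition preim_cover :: "'b topology \<Rightarrow> ('b \<Rightarrow> 'b) \<Rightarrow> 'b set set \<Rightarrow> 'b set set" where
  "preim_cover T g U = (\<lambda>u. topspace T \<inter> g -` u) ` U"

definition join_cover :: "'b set set \<Rightarrow> 'b set set \<Rightarrow> 'b set set" where
  "join_cover U V = {u \<inter> v | u v. u \<in> U \<and> v \<in> V}"

fun iter_join :: "'b topology \<Rightarrow> ('b \<Rightarrow> 'b) \<Rightarrow> 'b set set \<Rightarrow> nat \<Rightarrow> 'b set set" where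
  "iter_join T g U 0 = {topspace T}"
| "iter_join T g U (Suc n) = join_cover (iter_join T g U n) (preim_cover T (g ^^ n) U)"

definition min_subcover :: "'b topology \<Rightarrow> 'b set set \<Rightarrow> nat" where
  "min_subcover T U = (LEAST k. \<exists>V\<subseteq>U. finite V \<and> card V = k \<and> topspace T \<subseteq> (Union V))"

definition htop :: "'b topology \<Rightarrow> ('b \<Rightarrow> 'b) \<Rightarrow> ereal" where
  "htop T g = (SUP U \<in> {U. open_fin_cover T U}.
      ereal (lim (\<lambda>n. ln (real (min_subcover T (iter_join T g U n))) / real n)))"

definition Id_set :: "('a, 'm) ring_scheme \<Rightarrow> 'a set set" where
  "Id_set A = {I. ideal I A \<and> I \<noteq> carrier A}"

definition Spec :: "('a, 'm) ring_scheme \<Rightarrow> 'a set set" where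
  "Spec A = {P. primeideal P A}"

text \<open>constructible topology on a family S of ideals (induced from the product topology on {0,1}^A)\<close>
definition constructible_top :: "('a, 'm) ring_scheme \<Rightarrow> 'a set set \<Rightarrow> 'a set topology" where
  "constructible_top A S = topology_generated_by
     ({{I \<in> S. a \<in> I} | a. a \<in> carrier A} \<union> {{I \<in> S. a \<notin> I} | a. a \<in> carrier A})"

definition zariski_top :: "('a, 'm) ring_scheme \<Rightarrow> 'a set set \<Rightarrow> 'a set topology" where
  "zariski_top A S = topology_generated_by {{I \<in> S. a \<notin> I} | a. a \<in> carrier A}"

end

theory Submission
  imports Defs
begin

text \<open>
  By compactness of the constructible topology, every finite open cover is refined by the partition
  of the ideals according to their trace on a finite set \<open>E\<close>. So it suffices that for each \<open>a\<close> the
  number of sets \<open>{j. j < n \<and> (F ^^ j) a \<in> I}\<close>, with \<open>I\<close> an ideal, grows subexponentially in \<open>n\<close>.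
  As \<open>F\<close> fixes the scalars, \<open>a\<close> lies in an \<open>F\<close>-invariant subring \<open>B\<close> that is finitely generated
  over the integers, hence Noetherian. Such a set is determined by the subset \<open>Y\<close> of those \<open>j\<close>
  for which \<open>(F ^^ j) a\<close> is not in the ideal of \<open>B\<close> generated by the earlier terms. The family of
  all sets \<open>Y\<close> with this independence property is closed under subsets and left translations and
  has no infinite member, which forces its members in \<open>{..<n}\<close> to have size \<open>o(n)\<close>; and
  \<open>{..<n}\<close> has only subexponentially many subsets of size \<open>o(n)\<close>.
\<close>

section \<open>The Hilbert basis theorem for subrings\<close>

lemma mono_bounded_stabilizes:
  fixes T :: "nat \<Rightarrow> 'a set"
  assumes "mono T" "finite F" "\<And>k. T k \<subseteq> F"
  shows "\<exists>N. \<forall>k\<ge>N. T k = T N"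
proof -
  have "\<forall>k. card (T k) \<le> card F"
    using assms by (simp add: card_mono)
  then obtain N where N: "\<And>k. card (T k) \<le> card (T N)"
    using ex_has_greatest_nat[of "\<lambda>_. True" 0 "\<lambda>k. card (T k)" "Suc (card F)"] by (auto simp: less_Suc_eq_le)
  have "T k = T N" if "k \<ge> N" for k
  proof -
    have "T N \<subseteq> T k" "finite (T k)"
      using assms that by (auto simp: mono_def intro: finite_subset[OF assms(3)])
    then show ?thesis
      using N[of k] by (metis card_seteq)
  qed
  then show ?thesis by blast
qed

text \<open>This is the Noetherian property of \<open>K\<close>. The form with chains indexed by
  \<open>nat\<close> fits both the chains of leading coefficient ideals and the chains generated by
  an orbit.\<close>

definition acc_on :: "('a, 'm) ring_scheme \<Rightarrow> 'a set \<Rightarrow> bool" where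
  "acc_on R K \<longleftrightarrow> (\<forall>I :: nat \<Rightarrow> 'a set.
     (\<forall>k. ideal (I k) (R\<lparr>carrier := K\<rparr>)) \<longrightarrow> mono I \<longrightarrow> (\<exists>N. \<forall>k\<ge>N. I k = I N))"

context cring
begin

text \<open>Additive inverses come from multiplication by the negative of \<open>\<one>\<close>,
  which lies in \<open>K\<close>, and commutativity reduces two-sided absorption to one side. Ideals
  of different subrings can thus be handled as plain subsets of \<open>R\<close>.\<close>

lemma ideal_subring_iff:
  assumes "subring K R"
  shows "ideal I (R\<lparr>carrier := K\<rparr>) \<longleftrightarrow>
    I \<subseteq> K \<and> \<zero> \<in> I \<and> (\<forall>a\<in>I. \<forall>b\<in>I. a \<oplus> b \<in> I) \<and> (\<forall>a\<in>I. \<forall>r\<in>K. r \<otimes> a \<in> I)" (is "_ \<longleftrightarrow> ?P")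
proof
  assume "ideal I (R\<lparr>carrier := K\<rparr>)"
  then show ?P
    using additive_subgroup.a_subset[OF ideal.axioms(1)] additive_subgroup.zero_closed[OF ideal.axioms(1)]
      additive_subgroup.a_closed[OF ideal.axioms(1)] ideal.I_l_closed by fastforce
next
  note K = subringE[OF assms]
  assume P: ?P
  have inv: "\<ominus> a \<in> I" if "a \<in> I" for a
  proof -
    have "\<ominus> \<one> \<otimes> a \<in> I"
      using P K that by blast
    moreover have "a \<in> carrier R"
      using P K that by blast
    ultimately show ?thesis
      by (simp add: l_minus)
  qed
  let ?K = "R\<lparr>carrier := K\<rparr>"
  have ring: "ring ?K"
    using subring_is_ring[OF assms] .
  then have ab: "abelian_group ?K"
    by (rule ring.is_abelian_group)
  have "subgroup I (add_monoid ?K)"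
  proof (rule group.subgroupI[OF abelian_group.a_group[OF ab]])
    fix a assume a: "a \<in> I"
    \<comment> \<open>The structure with carrier \<open>K\<close> has its own additive inverse;
      uniqueness of inverses identifies it with that of \<open>R\<close>.\<close>
    have "\<ominus>\<^bsub>?K\<^esub> a = \<ominus> a"
    proof (rule abelian_group.minus_equality[OF ab])
      show "\<ominus> a \<oplus>\<^bsub>?K\<^esub> a = \<zero>\<^bsub>?K\<^esub>"
        using a P K by (auto intro: l_neg)
    qed (use a P inv in auto)
    then show "inv\<^bsub>add_monoid ?K\<^esub> a \<in> I"
      using inv[OF a] by (simp add: a_inv_def)
  qed (use P in auto)
  then show "ideal I ?K"
  proof (rule idealI[OF ring])
    fix a r assume "a \<in> I" and r: "r \<in> carrier ?K"
    then show "r \<otimes>\<^bsub>?K\<^esub> a \<in> I"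
      using P by simp
    moreover have "r \<otimes> a = a \<otimes> r"
      using \<open>a \<in> I\<close> r P K by (intro m_comm) auto
    ultimately show "a \<otimes>\<^bsub>?K\<^esub> r \<in> I"
      by simp
  qed
qed

section \<open>Ideals of the prime subring\<close>

text \<open>The prime subring consists of the integer multiples of \<open>\<one>\<close>. Once a
  chain contains a positive multiple \<open>n\<close>, each later ideal is determined by the
  residues below \<open>n\<close> that it contains, and a growing set of residues
  stabilizes.\<close>

lemma acc_on_prime_subring: "acc_on R (generate_ring R {})"
proof -
  let ?K = "generate_ring R {}" and ?z = "\<lambda>m::int. add_pow R m \<one>"
  have K: "subring ?K R"
    by (rule generate_ring_is_subring) simp
  have "\<exists>m::int. a = ?z m" if "a \<in> ?K" for a
    using that
  proof induction
    case one
    show ?case by (rule exI[of _ 1]) simp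
  next
    case (a_inv h)
    then obtain m :: int where "h = ?z m" by blast
    then have "\<ominus> h = ?z (- m)" by (simp add: add.int_pow_neg)
    then show ?case by blast
  next
    case (eng_add h1 h2)
    then obtain m n :: int where "h1 = ?z m" "h2 = ?z n" by blast
    then have "h1 \<oplus> h2 = ?z (m + n)" by (simp add: add.int_pow_mult)
    then show ?case by blast
  next
    case (eng_mult h1 h2)
    then obtain m n :: int where mn: "h1 = ?z m" "h2 = ?z n" by blast
    then have "h1 \<otimes> h2 = add_pow R m (?z n)"
      by (simp add: add_pow_ldistr_int)
    also have "\<dots> = ?z (m * n)"
      by (simp add: add.int_pow_pow mult.commute)
    finally show ?case by blast
  qed simp
  note K_int = this
  have int_K: "?z m \<in> ?K" for m :: int
  proof -
    have nat: "add_pow R k \<one> \<in> ?K" for k :: nat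
      by (induction k) (simp_all add: subringE(2,3,7)[OF K])
    then show ?thesis
      by (cases "m \<ge> 0") (simp_all add: add_pow_int_ge add_pow_int_lt subringE(5)[OF K])
  qed
  show ?thesis
    unfolding acc_on_def
  proof (intro allI impI)
    fix I :: "nat \<Rightarrow> 'a set"
    assume id: "\<forall>k. ideal (I k) (R\<lparr>carrier := ?K\<rparr>)" and "mono I"
    have I: "I k \<subseteq> ?K" "\<zero> \<in> I k" "\<And>a b. a \<in> I k \<Longrightarrow> b \<in> I k \<Longrightarrow> a \<oplus> b \<in> I k"
      "\<And>a r. a \<in> I k \<Longrightarrow> r \<in> ?K \<Longrightarrow> r \<otimes> a \<in> I k" for k
      using id ideal_subring_iff[OF K] by auto
    have mult: "?z (m * n) \<in> I k" if "?z n \<in> I k" for m n :: int and k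
    proof -
      have "?z (m * n) = ?z m \<otimes> ?z n"
        by (simp add: add_pow_ldistr_int add.int_pow_pow mult.commute)
      then show ?thesis using I(4)[OF that int_K] by metis
    qed
    have add: "?z (m + n) \<in> I k" if "?z m \<in> I k" "?z n \<in> I k" for m n :: int and k
      using I(3)[OF that] by (simp add: add.int_pow_mult)
    show "\<exists>N. \<forall>k\<ge>N. I k = I N"
    proof (cases "\<exists>n>0. \<exists>k. (?z (n::int)) \<in> I k")
      \<comment> \<open>Without positive multiples every ideal is zero: a nonzero \<open>m\<close>
        or its negative would be positive.\<close>
      case False
      have "I k = {\<zero>}" for k
      proof -
        have "a = \<zero>" if a: "a \<in> I k" for a
        proof -
          obtain m :: int where m: "a = ?z m"
            using K_int I(1) a by blast
          then have "?z ((-1) * m) \<in> I k"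
            using mult a by blast
          then have "m = 0"
            using False a m by (metis linorder_neqE_linordered_idom mult_minus1 neg_0_less_iff_less)
          then show ?thesis using m by (simp add: add_pow_int_ge)
        qed
        then show ?thesis using I(2) by blast
      qed
      then show ?thesis by simp
    next
      case True
      then obtain n :: int and N0 where n: "n > 0" "?z n \<in> I N0" by blast
      let ?T = "\<lambda>k. {r \<in> {0..<n}. ?z r \<in> I k}"
      have "mono ?T"
        using \<open>mono I\<close> by (auto simp: mono_def)
      then have "\<exists>N. \<forall>k\<ge>N. ?T k = ?T N"
        by (rule mono_bounded_stabilizes[where F = "{0..<n}"]) auto
      then obtain N where N: "\<And>k. k \<ge> N \<Longrightarrow> ?T k = ?T N" by blast
      \<comment> \<open>From \<open>N\<close> on the residues are frozen, and from \<open>N0\<close>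
        on the multiple \<open>n\<close> is present.\<close>
      let ?M = "max N N0"
      have "I k \<subseteq> I ?M" if k: "k \<ge> ?M" for k
      proof
        fix a assume a: "a \<in> I k"
        obtain m :: int where m: "a = ?z m"
          using K_int I(1) a by blast
        have nk: "?z n \<in> I k" "?z n \<in> I ?M"
          using n k monoD[OF \<open>mono I\<close>, of N0 k] monoD[OF \<open>mono I\<close>, of N0 ?M] by auto
        have "?z (m + (- (m div n)) * n) \<in> I k"
          using add mult a m nk by blast
        moreover have "m + (- (m div n)) * n = m mod n"
          by (simp add: minus_div_mult_eq_mod)
        ultimately have "m mod n \<in> ?T k"
          using n by simp
        moreover have "?T k = ?T ?M"
          by (rule trans[OF N N[symmetric]]) (use k in auto)
        ultimately have "m mod n \<in> ?T ?M"
          by (simp only:)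
        then have "?z (m mod n + (m div n) * n) \<in> I ?M"
          using add mult nk by blast
        then show "a \<in> I ?M"
          using m by simp
      qed
      then have "\<forall>k\<ge>?M. I k = I ?M"
        using \<open>mono I\<close> by (meson equalityI monoD)
      then show ?thesis by blast
    qed
  qed
qed

section \<open>Values of polynomials at an element\<close>

text \<open>The values at \<open>x\<close> of the polynomials over \<open>K\<close> of degree less than \<open>d\<close>. Since \<open>x\<close> may be
  algebraic over \<open>K\<close>, an element can have several presentations, so below a ``leading
  coefficient'' belongs to a presentation and not to an element.\<close>

fun polys_below :: "'a set \<Rightarrow> 'a \<Rightarrow> nat \<Rightarrow> 'a set" where
  "polys_below K x 0 = {\<zero>}"
| "polys_below K x (Suc d) = {c \<otimes> x [^] d \<oplus> p | c p. c \<in> K \<and> p \<in> polys_below K x d}"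

lemma polys_below_SucI:
  "c \<in> K \<Longrightarrow> p \<in> polys_below K x d \<Longrightarrow> c \<otimes> x [^] d \<oplus> p \<in> polys_below K x (Suc d)"
  by auto

declare polys_below.simps(2) [simp del]

context
  fixes K x
  assumes K: "subring K R" and x: "x \<in> carrier R"
begin

lemma mem_subring_closed: "c \<in> K \<Longrightarrow> c \<in> carrier R"
  using subringE(1)[OF K] by blast

lemma polys_below_closed: "p \<in> polys_below K x d \<Longrightarrow> p \<in> carrier R"
  by (induction d arbitrary: p) (auto simp: mem_subring_closed x polys_below.simps)

lemma zero_in_polys_below: "\<zero> \<in> polys_below K x d"
proof (induction d)
  case (Suc d)
  have "\<zero> = \<zero> \<otimes> x [^] d \<oplus> \<zero>"
    using x by simp
  then show ?case
    using polys_below_SucI[OF subringE(2)[OF K] Suc] by simp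
qed simp

lemma polys_below_Suc: "p \<in> polys_below K x d \<Longrightarrow> p \<in> polys_below K x (Suc d)"
proof -
  assume p: "p \<in> polys_below K x d"
  then have "p = \<zero> \<otimes> x [^] d \<oplus> p"
    using x polys_below_closed[OF p] by simp
  then show ?thesis
    using polys_below_SucI[OF subringE(2)[OF K] p] by simp
qed

lemma polys_below_mono: "d \<le> e \<Longrightarrow> polys_below K x d \<subseteq> polys_below K x e"
  by (rule lift_Suc_mono_le[of "polys_below K x"]) (use polys_below_Suc in blast)+

lemma polys_below_add:
  "p \<in> polys_below K x d \<Longrightarrow> q \<in> polys_below K x d \<Longrightarrow> p \<oplus> q \<in> polys_below K x d"
proof (induction d arbitrary: p q)
  case (Suc d)
  then obtain b c p' q' where *: "p = b \<otimes> x [^] d \<oplus> p'" "q = c \<otimes> x [^] d \<oplus> q'"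
    "b \<in> K" "c \<in> K" "p' \<in> polys_below K x d" "q' \<in> polys_below K x d"
    by (auto simp: polys_below.simps)
  have "b \<otimes> x [^] d \<in> carrier R" "c \<otimes> x [^] d \<in> carrier R" "p' \<in> carrier R" "q' \<in> carrier R"
    using * polys_below_closed mem_subring_closed x by auto
  then have "p \<oplus> q = (b \<otimes> x [^] d \<oplus> c \<otimes> x [^] d) \<oplus> (p' \<oplus> q')"
    unfolding * by (simp add: a_ac)
  also have "\<dots> = (b \<oplus> c) \<otimes> x [^] d \<oplus> (p' \<oplus> q')"
    using * x by (simp add: l_distr mem_subring_closed)
  finally show ?case
    using * Suc.IH subringE(7)[OF K] polys_below_SucI by simp
qed simp

lemma polys_below_smult:
  "c \<in> K \<Longrightarrow> p \<in> polys_below K x d \<Longrightarrow> c \<otimes> p \<in> polys_below K x d"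
proof (induction d arbitrary: p)
  case (Suc d)
  then obtain b p' where *: "p = b \<otimes> x [^] d \<oplus> p'" "b \<in> K" "p' \<in> polys_below K x d"
    by (auto simp: polys_below.simps)
  then have "c \<otimes> p = (c \<otimes> b) \<otimes> x [^] d \<oplus> c \<otimes> p'"
    using Suc.prems x polys_below_closed by (simp add: r_distr m_assoc mem_subring_closed)
  then show ?case
    using * Suc.IH Suc.prems subringE(6)[OF K] polys_below_SucI by simp
qed (auto simp: mem_subring_closed)

lemma polys_below_minus: "p \<in> polys_below K x d \<Longrightarrow> \<ominus> p \<in> polys_below K x d"
  using polys_below_smult[of "\<ominus> \<one>" p d] subringE(3,5)[OF K] polys_below_closed
  by (simp add: l_minus)

lemma polys_below_shift:
  "p \<in> polys_below K x d \<Longrightarrow> x \<otimes> p \<in> polys_below K x (Suc d)"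
proof (induction d arbitrary: p)
  case 0
  then show ?case using x zero_in_polys_below[of 1] by simp
next
  case (Suc d)
  then obtain b p' where *: "p = b \<otimes> x [^] d \<oplus> p'" "b \<in> K" "p' \<in> polys_below K x d"
    by (auto simp: polys_below.simps)
  then have "x \<otimes> p = b \<otimes> x [^] Suc d \<oplus> x \<otimes> p'"
    using x polys_below_closed by (simp add: r_distr m_ac mem_subring_closed)
  then show ?case
    using polys_below_SucI[OF *(2) Suc.IH[OF *(3)]] by simp
qed

lemma polys_below_shift_pow:
  "p \<in> polys_below K x d \<Longrightarrow> x [^] (e::nat) \<otimes> p \<in> polys_below K x (e + d)"
proof (induction e)
  case 0
  then show ?case using polys_below_closed by simp
next
  case (Suc e)
  then have "x \<otimes> (x [^] e \<otimes> p) \<in> polys_below K x (Suc (e + d))"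
    using polys_below_shift by blast
  then show ?case
    using x polys_below_closed[OF Suc.prems] by (simp add: m_ac)
qed

lemma polys_below_mult:
  "p \<in> polys_below K x d \<Longrightarrow> q \<in> polys_below K x e \<Longrightarrow> p \<otimes> q \<in> polys_below K x (d + e)"
proof (induction d arbitrary: p)
  case 0
  then show ?case using zero_in_polys_below polys_below_closed by simp
next
  case (Suc d)
  then obtain b p' where *: "p = b \<otimes> x [^] d \<oplus> p'" "b \<in> K" "p' \<in> polys_below K x d"
    by (auto simp: polys_below.simps)
  then have "p \<otimes> q = b \<otimes> (x [^] d \<otimes> q) \<oplus> p' \<otimes> q"
    using x polys_below_closed[OF Suc.prems(2)] polys_below_closed[OF *(3)]
    by (simp add: l_distr m_assoc mem_subring_closed)
  moreover have "b \<otimes> (x [^] d \<otimes> q) \<in> polys_below K x (d + e)"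
    using polys_below_smult polys_below_shift_pow * Suc.prems by blast
  ultimately have "p \<otimes> q \<in> polys_below K x (d + e)"
    using polys_below_add Suc.IH[OF *(3) Suc.prems(2)] by simp
  then show ?case
    using polys_below_Suc by simp
qed

lemma subring_polys: "subring (\<Union>d. polys_below K x d) R"
proof (rule subringI)
  have "\<one> \<otimes> x [^] (0::nat) \<oplus> \<zero> \<in> polys_below K x (Suc 0)"
    using subringE(3)[OF K] by (intro polys_below_SucI) auto
  then have "\<one> \<in> polys_below K x (Suc 0)"
    by simp
  then show "\<one> \<in> (\<Union>d. polys_below K x d)" by blast
next
  fix p q
  assume "p \<in> (\<Union>d. polys_below K x d)" "q \<in> (\<Union>d. polys_below K x d)"
  then obtain d e where pq: "p \<in> polys_below K x d" "q \<in> polys_below K x e" by blast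
  then have "p \<in> polys_below K x (max d e)" "q \<in> polys_below K x (max d e)"
    using polys_below_mono[of d "max d e"] polys_below_mono[of e "max d e"] by auto
  then show "p \<oplus> q \<in> (\<Union>d. polys_below K x d)"
    using polys_below_add by blast
  show "p \<otimes> q \<in> (\<Union>d. polys_below K x d)"
    using polys_below_mult pq by blast
qed (use polys_below_closed polys_below_minus in blast)+

text \<open>The polynomial values form a subring containing \<open>K\<close> and \<open>x\<close>.
  Having such a presentation for every element of the extension is what allows induction on the
  formal degree.\<close>

lemma generate_ring_insert_subset_polys:
  "generate_ring R (insert x K) \<subseteq> (\<Union>d. polys_below K x d)"
proof (rule generate_ring_min_subring1[OF _ subring_polys])
  have "c \<in> polys_below K x (Suc 0)" if "c \<in> K" for c
  proof -
    have "c = c \<otimes> x [^] (0::nat) \<oplus> \<zero>"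
      using mem_subring_closed that by simp
    then show ?thesis
      using polys_below_SucI[OF that, of \<zero> x 0] by simp
  qed
  moreover from this have "x \<otimes> \<one> \<in> polys_below K x (Suc (Suc 0))"
    using subringE(3)[OF K] by (intro polys_below_shift)
  ultimately show "insert x K \<subseteq> (\<Union>d. polys_below K x d)"
    using x by auto
qed (use x mem_subring_closed in auto)

section \<open>Ideals of leading coefficients\<close>

definition lead_coeffs :: "'a set \<Rightarrow> nat \<Rightarrow> 'a set" where
  "lead_coeffs I d = {c \<in> K. \<exists>p\<in>polys_below K x d. c \<otimes> x [^] d \<oplus> p \<in> I}"

context
  fixes L
  assumes L_def: "L = generate_ring R (insert x K)"
begin

lemma L_subring: "subring L R"
  unfolding L_def by (rule generate_ring_is_subring) (use x mem_subring_closed in auto)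

lemma K_subset_L: "K \<subseteq> L"
  unfolding L_def by (auto intro: generate_ring.incl)

lemma x_in_L: "x \<in> L"
  unfolding L_def by (auto intro: generate_ring.incl)

lemma ideal_lead_coeffs:
  assumes "ideal I (R\<lparr>carrier := L\<rparr>)"
  shows "ideal (lead_coeffs I d) (R\<lparr>carrier := K\<rparr>)"
  unfolding ideal_subring_iff[OF K]
proof (intro conjI ballI)
  note I = assms[unfolded ideal_subring_iff[OF L_subring]]
  show "lead_coeffs I d \<subseteq> K"
    unfolding lead_coeffs_def by blast
  have "\<zero> \<otimes> x [^] d \<oplus> \<zero> \<in> I"
    using I x by simp
  then show "\<zero> \<in> lead_coeffs I d"
    unfolding lead_coeffs_def using zero_in_polys_below subringE(2)[OF K] by blast
  fix b assume "b \<in> lead_coeffs I d"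
  then obtain p where p: "p \<in> polys_below K x d" "b \<otimes> x [^] d \<oplus> p \<in> I" and b: "b \<in> K"
    unfolding lead_coeffs_def by blast
  {
    fix c assume "c \<in> lead_coeffs I d"
    then obtain q where q: "q \<in> polys_below K x d" "c \<otimes> x [^] d \<oplus> q \<in> I" and c: "c \<in> K"
      unfolding lead_coeffs_def by blast
    have "b \<otimes> x [^] d \<in> carrier R" "c \<otimes> x [^] d \<in> carrier R" "p \<in> carrier R" "q \<in> carrier R"
      using b c p q polys_below_closed mem_subring_closed x by auto
    then have "(b \<otimes> x [^] d \<oplus> p) \<oplus> (c \<otimes> x [^] d \<oplus> q) =
        (b \<otimes> x [^] d \<oplus> c \<otimes> x [^] d) \<oplus> (p \<oplus> q)"
      by (simp add: a_ac)
    also have "\<dots> = (b \<oplus> c) \<otimes> x [^] d \<oplus> (p \<oplus> q)"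
      using b c x by (simp add: l_distr mem_subring_closed)
    finally have "(b \<oplus> c) \<otimes> x [^] d \<oplus> (p \<oplus> q) \<in> I"
      using I p q by metis
    then show "b \<oplus> c \<in> lead_coeffs I d"
      unfolding lead_coeffs_def using b c p q polys_below_add subringE(7)[OF K] by blast
  }
  fix r assume r: "r \<in> K"
  then have "r \<otimes> (b \<otimes> x [^] d \<oplus> p) \<in> I"
    using I p K_subset_L by blast
  moreover have "r \<otimes> (b \<otimes> x [^] d \<oplus> p) = (r \<otimes> b) \<otimes> x [^] d \<oplus> r \<otimes> p"
    using r b x polys_below_closed[OF p(1)] by (simp add: r_distr m_assoc mem_subring_closed)
  ultimately show "r \<otimes> b \<in> lead_coeffs I d"
    unfolding lead_coeffs_def using r b p polys_below_smult subringE(6)[OF K] by auto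
qed

text \<open>Multiplication by \<open>x\<close> raises the formal degree and keeps the leading
  coefficient.\<close>

lemma lead_coeffs_Suc:
  assumes "ideal I (R\<lparr>carrier := L\<rparr>)"
  shows "lead_coeffs I d \<subseteq> lead_coeffs I (Suc d)"
proof
  note I = assms[unfolded ideal_subring_iff[OF L_subring]]
  fix b assume "b \<in> lead_coeffs I d"
  then obtain p where p: "p \<in> polys_below K x d" "b \<otimes> x [^] d \<oplus> p \<in> I" and b: "b \<in> K"
    unfolding lead_coeffs_def by blast
  have "x \<otimes> (b \<otimes> x [^] d \<oplus> p) \<in> I"
    using I p x_in_L by blast
  moreover have "x \<otimes> (b \<otimes> x [^] d \<oplus> p) = b \<otimes> x [^] (Suc d) \<oplus> x \<otimes> p"
    using b x polys_below_closed[OF p(1)] by (simp add: r_distr m_ac mem_subring_closed)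
  ultimately show "b \<in> lead_coeffs I (Suc d)"
    unfolding lead_coeffs_def using b polys_below_shift[OF p(1)] by auto
qed

text \<open>Induction on the formal degree: from an element of \<open>J\<close> subtract an element
  of \<open>I\<close> with the same top coefficient. The remainder lies in \<open>J\<close> and has
  a shorter presentation, hence lies in \<open>I\<close>.\<close>

lemma ideal_subset_if_lead_coeffs_subset:
  assumes I: "ideal I (R\<lparr>carrier := L\<rparr>)" and J: "ideal J (R\<lparr>carrier := L\<rparr>)"
    and "I \<subseteq> J" and lead: "\<And>d. lead_coeffs J d \<subseteq> lead_coeffs I d"
  shows "J \<subseteq> I"
proof -
  note I' = I[unfolded ideal_subring_iff[OF L_subring]]
  note J' = J[unfolded ideal_subring_iff[OF L_subring]]
  have minus: "\<ominus> a \<in> J" if "a \<in> J" for a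
  proof -
    have "\<ominus> \<one> \<otimes> a \<in> J"
      using J' that subringE(3,5)[OF L_subring] by blast
    moreover have "a \<in> carrier R"
      using that J' subringE(1)[OF L_subring] by blast
    ultimately show ?thesis
      by (simp add: l_minus)
  qed
  have "y \<in> I" if "y \<in> J" "y \<in> polys_below K x d" for y d
    using that
  proof (induction d arbitrary: y)
    case 0
    then show ?case using I' by simp
  next
    case (Suc d)
    then obtain c p where y: "y = c \<otimes> x [^] d \<oplus> p" and c: "c \<in> K" and p: "p \<in> polys_below K x d"
      by (auto simp: polys_below.simps)
    then have "c \<in> lead_coeffs J d"
      unfolding lead_coeffs_def using Suc.prems by blast
    then obtain q where q: "q \<in> polys_below K x d" "c \<otimes> x [^] d \<oplus> q \<in> I"
      using lead unfolding lead_coeffs_def by blast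
    let ?z = "c \<otimes> x [^] d"
    have z: "?z \<in> carrier R" "p \<in> carrier R" "q \<in> carrier R"
      using c x p q mem_subring_closed polys_below_closed by auto
    have "y \<oplus> \<ominus> (?z \<oplus> q) = (?z \<oplus> \<ominus> ?z) \<oplus> (p \<oplus> \<ominus> q)"
      unfolding y using z by (simp add: minus_add a_ac)
    then have "y \<oplus> \<ominus> (?z \<oplus> q) = p \<oplus> \<ominus> q"
      using z by (simp add: r_neg)
    moreover have "y \<oplus> \<ominus> (?z \<oplus> q) \<in> J"
      using Suc.prems q minus J' \<open>I \<subseteq> J\<close> by blast
    moreover have "p \<oplus> \<ominus> q \<in> polys_below K x d"
      using p q polys_below_add polys_below_minus by blast
    ultimately have "p \<oplus> \<ominus> q \<in> I"
      using Suc.IH by simp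
    then have "(p \<oplus> \<ominus> q) \<oplus> (?z \<oplus> q) \<in> I"
      using q I' by blast
    moreover have "(p \<oplus> \<ominus> q) \<oplus> (?z \<oplus> q) = y"
      unfolding y using z by (simp add: a_ac r_neg1 r_neg2)
    ultimately show ?case by simp
  qed
  moreover have "J \<subseteq> (\<Union>d. polys_below K x d)"
    using J' generate_ring_insert_subset_polys unfolding L_def by blast
  ultimately show ?thesis by blast
qed

text \<open>Hilbert's argument: leading coefficient ideals increase both in the degree and in the
  index of the chain. The diagonal settles all large degrees at once, and the finitely many small
  degrees are settled one by one.\<close>

lemma acc_on_adjoin:
  assumes acc: "acc_on R K"
  shows "acc_on R L"
  unfolding acc_on_def
proof (intro allI impI)
  fix I :: "nat \<Rightarrow> 'a set"
  assume I: "\<forall>k. ideal (I k) (R\<lparr>carrier := L\<rparr>)" and "mono I"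
  let ?C = "\<lambda>d k. lead_coeffs (I k) d"
  have mono_deg: "?C d k \<subseteq> ?C e k" if "d \<le> e" for d e k
    using lift_Suc_mono_le[of "\<lambda>d. ?C d k", OF _ that] lead_coeffs_Suc I by blast
  have mono_ix: "?C d k \<subseteq> ?C d l" if "k \<le> l" for d k l
    using monoD[OF \<open>mono I\<close> that] unfolding lead_coeffs_def by blast
  have stab: "\<exists>N. \<forall>k\<ge>N. J k = J N" if "\<And>k. ideal (J k) (R\<lparr>carrier := K\<rparr>)" "mono J" for J :: "nat \<Rightarrow> 'a set"
    using acc that unfolding acc_on_def by blast
  have "mono (\<lambda>n. ?C n n)"
    using mono_deg mono_ix by (intro monoI) (meson subset_trans)
  then obtain N where N: "\<And>k. k \<ge> N \<Longrightarrow> ?C k k = ?C N N"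
    using stab[of "\<lambda>n. ?C n n"] ideal_lead_coeffs I by blast
  have "\<exists>M. \<forall>k\<ge>M. ?C d k = ?C d M" for d
    using stab[of "?C d"] ideal_lead_coeffs I mono_ix by (simp add: mono_def)
  then obtain M where M: "\<And>d k. k \<ge> M d \<Longrightarrow> ?C d k = ?C d (M d)" by metis
  define N' where "N' = max N (Max (M ` {..N}))"
  have "?C d k \<subseteq> ?C d N'" if k: "k \<ge> N'" for d k
  proof (cases "d \<le> N")
    case True
    then have "M d \<le> Max (M ` {..N})"
      by (intro Max_ge) auto
    then have "M d \<le> N'"
      by (simp add: N'_def)
    then show ?thesis
      using M[of d N'] M[of d k] k by auto
  next
    case False
    \<comment> \<open>For \<open>d\<close> above \<open>N\<close> the ideals are squeezed between
      \<open>?C N N\<close> and a later diagonal term, and these two are equal.\<close>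
    have "?C d k \<subseteq> ?C (max d k) (max d k)"
      using mono_deg[of d "max d k"] mono_ix[of k "max d k"] by (meson max.cobounded1 max.cobounded2 subset_trans)
    also have "\<dots> = ?C N N"
      using False by (intro N) auto
    also have "\<dots> \<subseteq> ?C d N'"
      using False mono_deg[of N d] mono_ix[of N N'] unfolding N'_def
      by (meson max.cobounded1 nat_le_linear subset_trans)
    finally show ?thesis .
  qed
  then have "I k \<subseteq> I N'" if "k \<ge> N'" for k
    using ideal_subset_if_lead_coeffs_subset[of "I N'" "I k"] I monoD[OF \<open>mono I\<close> that] that
    by blast
  then have "\<forall>k\<ge>N'. I k = I N'"
    using \<open>mono I\<close> by (meson equalityI monoD)
  then show "\<exists>N. \<forall>k\<ge>N. I k = I N" by blast
qed

end

end

text \<open>The generators are adjoined one at a time, starting from the prime subring.\<close>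

lemma acc_on_generate_ring:
  assumes "finite H" "H \<subseteq> carrier R"
  shows "acc_on R (generate_ring R H)"
  using assms
proof (induction H)
  case empty
  show ?case by (rule acc_on_prime_subring)
next
  case (insert x H)
  let ?K = "generate_ring R H"
  have "generate_ring R (insert x H) = generate_ring R (insert x ?K)"
  proof
    show "generate_ring R (insert x H) \<subseteq> generate_ring R (insert x ?K)"
      using insert generate_ring_incl by (intro mono_generate_ring) (auto intro: generate_ring.incl)
    show "generate_ring R (insert x ?K) \<subseteq> generate_ring R (insert x H)"
      using insert generate_ring_incl mono_generate_ring[of H "insert x H"]
      by (intro generate_ring_min_subring1 generate_ring_is_subring) (auto intro: generate_ring.incl)
  qed
  moreover have "acc_on R (generate_ring R (insert x ?K))"
    using insert by (intro acc_on_adjoin[OF _ _ refl] generate_ring_is_subring) auto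
  ultimately show ?case by simp
qed

end

section \<open>Sparse families of sets of natural numbers\<close>

text \<open>Cut off sparse prefixes repeatedly; each cut leaves a translate of a member of \<open>FF\<close>.\<close>

lemma card_le_if_sparse_prefixes:
  fixes c :: real and FF :: "nat set set"
  assumes sub: "\<And>Y Z. Y \<in> FF \<Longrightarrow> Z \<subseteq> Y \<Longrightarrow> Z \<in> FF"
    and shift: "\<And>Y. Suc ` Y \<in> FF \<Longrightarrow> Y \<in> FF"
    and block: "\<And>Y. Y \<in> FF \<Longrightarrow> Y \<subseteq> {..<m} \<Longrightarrow> \<exists>k. 1 \<le> k \<and> k \<le> m \<and> card (Y \<inter> {..<k}) \<le> c * k"
    and c: "c \<ge> 0"
  shows "Y \<in> FF \<Longrightarrow> Y \<subseteq> {..<n} \<Longrightarrow> card Y \<le> c * n + m"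
proof (induction n arbitrary: Y rule: less_induct)
  case (less n)
  show ?case
  proof (cases "n \<le> m")
    case True
    have "card Y \<le> n"
      using card_mono[OF _ less.prems(2)] by simp
    moreover have "c * n \<ge> 0"
      using c by simp
    ultimately show ?thesis using True by linarith
  next
    case False
    have shiftk: "Z \<in> FF" if "(\<lambda>i. i + k) ` Z \<in> FF" for k Z
      using that
    proof (induction k arbitrary: Z)
      case (Suc k)
      have "(\<lambda>i. i + Suc k) ` Z = Suc ` (\<lambda>i. i + k) ` Z"
        by (simp add: image_image)
      with Suc.prems have "Suc ` (\<lambda>i. i + k) ` Z \<in> FF" by simp
      then show ?case by (rule Suc.IH[OF shift])
    qed simp
    \<comment> \<open>The hypothesis \<open>block\<close> concerns subsets of \<open>{..<m}\<close>
      only, so it is applied to a truncation of \<open>Y\<close>. As \<open>k \<le> m\<close>,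
      truncating does not change the count below \<open>k\<close>.\<close>
    obtain k where k: "1 \<le> k" "k \<le> m" "card ((Y \<inter> {..<m}) \<inter> {..<k}) \<le> c * k"
      using block[OF sub[OF less.prems(1)], of "Y \<inter> {..<m}"] by auto
    then have 1: "card (Y \<inter> {..<k}) \<le> c * k"
    proof -
      have "Y \<inter> {..<m} \<inter> {..<k} = Y \<inter> {..<k}"
        using k(2) by auto
      then show ?thesis using k(3) by simp
    qed
    let ?Z = "(\<lambda>i. i - k) ` (Y - {..<k})"
    have *: "(\<lambda>i. i + k) ` ?Z = Y - {..<k}"
    proof -
      have "(\<lambda>i. i - k + k) ` (Y - {..<k}) = (\<lambda>i. i) ` (Y - {..<k})"
        by (rule image_cong) auto
      then show ?thesis by (simp add: image_image)
    qed
    then have "?Z \<in> FF"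
      using shiftk[of k ?Z] sub[OF less.prems(1), of "Y - {..<k}"] by auto
    moreover have "?Z \<subseteq> {..<n - k}"
      using less.prems(2) by (auto simp: diff_less_mono)
    ultimately have 2: "card ?Z \<le> c * (n - k) + m"
      using less.IH[of "n - k" ?Z] k False by simp
    have fin: "finite Y"
      using less.prems(2) finite_subset by blast
    have "inj_on (\<lambda>i. i - k) (Y - {..<k})"
      by (auto simp: inj_on_def)
    then have "card (Y - {..<k}) = card ?Z"
      by (rule card_image[symmetric])
    then have "card Y = card (Y \<inter> {..<k}) + card ?Z"
      using card_Int_Diff[OF fin, of "{..<k}"] by simp
    moreover have "c * real (n - k) = c * n - c * k"
      using k False by (simp add: of_nat_diff algebra_simps)
    ultimately show ?thesis
      using 1 2 by linarith
  qed
qed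

text \<open>Otherwise, by Koenig's lemma, some infinite set all of whose initial segments lie in
  \<open>FF\<close> would have density at least \<open>c\<close> in each of them.\<close>

lemma sparse_if_no_infinite:
  fixes c :: real and FF :: "nat set set"
  assumes sub: "\<And>Y Z. Y \<in> FF \<Longrightarrow> Z \<subseteq> Y \<Longrightarrow> Z \<in> FF"
    and shift: "\<And>Y. Suc ` Y \<in> FF \<Longrightarrow> Y \<in> FF"
    and no_inf: "\<And>J. infinite J \<Longrightarrow> \<exists>k. J \<inter> {..<k} \<notin> FF"
    and c: "c > 0"
  shows "\<exists>m::nat. \<forall>n. \<forall>Y\<in>FF. Y \<subseteq> {..<n} \<longrightarrow> card Y \<le> c * n + m"
proof (rule ccontr)
  assume neg: "\<not> ?thesis"
  \<comment> \<open>If this failed for some \<open>m\<close>, every member inside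
    \<open>{..<m}\<close> would have a sparse prefix, and the cutting argument would give the
    excluded bound with this \<open>m\<close> as additive constant.\<close>
  have "\<exists>Y\<in>FF. Y \<subseteq> {..<m} \<and> (\<forall>k. 1 \<le> k \<and> k \<le> m \<longrightarrow> card (Y \<inter> {..<k}) > c * k)" for m
  proof (rule ccontr)
    assume "\<not> ?thesis"
    then have block: "\<exists>k. 1 \<le> k \<and> k \<le> m \<and> card (Y \<inter> {..<k}) \<le> c * k" if "Y \<in> FF" "Y \<subseteq> {..<m}" for Y
      using that by (meson not_le)
    have "card Y \<le> c * n + m" if "Y \<in> FF" "Y \<subseteq> {..<n}" for n Y
      by (rule card_le_if_sparse_prefixes[OF sub shift block less_imp_le[OF c] that])
    then show False using neg by blast
  qed
  then obtain D where D: "\<And>m. D m \<in> FF"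
    "\<And>m k. 1 \<le> k \<Longrightarrow> k \<le> m \<Longrightarrow> card (D m \<inter> {..<k}) > c * k"
    by metis
  \<comment> \<open>These are the nodes of the Koenig tree: traces on \<open>{..<k}\<close> shared
    by infinitely many \<open>D m\<close>. Such a node keeps an infinite branch either with or
    without the new element \<open>k\<close>.\<close>
  define P where "P k W \<longleftrightarrow> W \<subseteq> {..<k} \<and> infinite {m. D m \<inter> {..<k} = W}" for k W
  have "\<exists>f. \<forall>k. P k (f k) \<and> f (Suc k) \<inter> {..<k} = f k"
  proof (rule dependent_nat_choice)
    show "\<exists>W. P 0 W" by (auto simp: P_def)
  next
    fix W k assume W: "P k W"
    have "{m. D m \<inter> {..<k} = W} =
      {m. D m \<inter> {..<Suc k} = W} \<union> {m. D m \<inter> {..<Suc k} = insert k W}"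
      using W by (auto simp: P_def lessThan_Suc)
    then have "infinite {m. D m \<inter> {..<Suc k} = W} \<or> infinite {m. D m \<inter> {..<Suc k} = insert k W}"
      using W unfolding P_def by (metis finite_UnI)
    moreover have "W \<subseteq> {..<k}"
      using W by (simp add: P_def)
    ultimately have "P (Suc k) W \<or> P (Suc k) (insert k W)"
      unfolding P_def by (auto simp: lessThan_Suc)
    moreover have "W \<inter> {..<k} = W" "insert k W \<inter> {..<k} = W"
      using \<open>W \<subseteq> {..<k}\<close> by auto
    ultimately show "\<exists>Y. P (Suc k) Y \<and> Y \<inter> {..<k} = W" by metis
  qed
  then obtain f where f: "\<And>k. P k (f k)" "\<And>k. f (Suc k) \<inter> {..<k} = f k" by blast
  have init: "f l \<inter> {..<k} = f k" if "k \<le> l" for k l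
    using that
  proof (induction l rule: dec_induct)
    case base
    then show ?case using f(1)[of k] by (auto simp: P_def)
  next
    case (step l)
    have "f (Suc l) \<inter> {..<k} = f (Suc l) \<inter> {..<l} \<inter> {..<k}"
      using step(1) by auto
    then show ?case using step f(2) by simp
  qed
  define J where "J = (\<Union>k. f k)"
  have J: "J \<inter> {..<k} = f k" for k
  proof
    show "J \<inter> {..<k} \<subseteq> f k"
    proof
      fix i assume "i \<in> J \<inter> {..<k}"
      then obtain l where "i \<in> f l" "i < k" by (auto simp: J_def)
      then show "i \<in> f k"
        using init[of k l] init[of l k] by (cases "k \<le> l") auto
    qed
    show "f k \<subseteq> J \<inter> {..<k}"
      using f(1)[of k] by (auto simp: J_def P_def)
  qed
  \<comment> \<open>Infinitude supplies some \<open>m \<ge> k\<close>; the density bound on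
    \<open>D m\<close> reaches only the prefixes of length at most \<open>m\<close>.\<close>
  have ex: "\<exists>m\<ge>k. D m \<inter> {..<k} = f k" for k
    using f(1)[of k] unfolding P_def by (metis (mono_tags, lifting) infinite_nat_iff_unbounded_le mem_Collect_eq)
  have "J \<inter> {..<k} \<in> FF" for k
    using ex[of k] D(1) sub J by (metis inf_le1)
  then have "finite J"
    using no_inf by blast
  \<comment> \<open>As \<open>J\<close> is finite, a long enough prefix has density below
    \<open>c\<close>; \<open>k \<ge> 1\<close> is demanded by the density bound on
    \<open>D\<close>.\<close>
  obtain k :: nat where k: "c * k > card J" "k \<ge> 1"
  proof -
    obtain k :: nat where "real k > max 1 (card J / c)"
      using reals_Archimedean2 by blast
    then show ?thesis
      using c by (intro that[of k]) (auto simp: field_simps)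
  qed
  obtain m where "m \<ge> k" "D m \<inter> {..<k} = J \<inter> {..<k}"
    using ex[of k] J by metis
  then have "card (J \<inter> {..<k}) > c * k"
    using D(2)[OF k(2)] by metis
  moreover have "card (J \<inter> {..<k}) \<le> card J"
    using \<open>finite J\<close> by (simp add: card_mono)
  ultimately show False using k(1) by linarith
qed

section \<open>Counting sets of small size\<close>

text \<open>A Chernoff-type count: give \<open>Y\<close> the weight \<open>t ^ card Y\<close>. Over
  all subsets of \<open>{..<n}\<close> the weights sum to \<open>(1 + t) ^ n\<close>, and since
  \<open>t \<le> 1\<close> each member of \<open>G\<close> weighs at least
  \<open>t powr b\<close>.\<close>

lemma card_small_subsets_le:
  fixes t b :: real
  assumes "0 < t" "t \<le> 1" and "\<And>Y. Y \<in> G \<Longrightarrow> Y \<subseteq> {..<n} \<and> card Y \<le> b"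
  shows "card G * t powr b \<le> (1 + t) ^ n"
proof -
  have G: "G \<subseteq> Pow {..<n}" using assms(3) by blast
  have "card G * t powr b = (\<Sum>Y\<in>G. t powr b)"
    by simp
  also have "\<dots> \<le> (\<Sum>Y\<in>G. t ^ card Y)"
  proof (rule sum_mono)
    fix Y assume "Y \<in> G"
    then have "t powr b \<le> t powr (card Y)"
      using assms by (intro powr_mono') auto
    then show "t powr b \<le> t ^ card Y"
      using assms by (simp add: powr_realpow)
  qed
  also have "\<dots> \<le> (\<Sum>Y\<in>Pow {..<n}. t ^ card Y)"
    using G assms by (intro sum_mono2) auto
  also have "\<dots> = (\<Prod>i<n. t + 1)"
    by (subst prod_add) auto
  finally show ?thesis by (simp add: add.commute)
qed

lemma subexponential_if_sparse:
  fixes G :: "nat \<Rightarrow> nat set set"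
  assumes sub: "\<And>n Y. Y \<in> G n \<Longrightarrow> Y \<subseteq> {..<n}"
    and sparse: "\<And>c::real. c > 0 \<Longrightarrow> \<exists>m::nat. \<forall>n. \<forall>Y\<in>G n. card Y \<le> c * n + m"
  shows "(\<lambda>n. ln (card (G n)) / n) \<longlonglongrightarrow> 0"
proof (rule LIMSEQ_I)
  fix r :: real assume r: "r > 0"
  \<comment> \<open>The logarithm of the count splits into three parts, each worth at most a third
    of \<open>r * n\<close>: \<open>t\<close> controls \<open>ln (1 + t)\<close>, \<open>c\<close>
    is chosen to make \<open>c * l\<close> equal to \<open>r / 3\<close>, and a large
    \<open>n\<close> absorbs \<open>m * l\<close>.\<close>
  define t where "t = min (1/2) (r / 3)"
  have t: "0 < t" "t < 1" "t \<le> r / 3" using r by (auto simp: t_def)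
  define l where "l = - ln t"
  have l: "l > 0" using t by (simp add: l_def)
  define c where "c = r / (3 * l)"
  have c: "c > 0" "c * l = r / 3" using r l by (auto simp: c_def)
  obtain m :: nat where m: "\<And>n Y. Y \<in> G n \<Longrightarrow> card Y \<le> c * n + m"
    using sparse[OF c(1)] by blast
  obtain N :: nat where N: "real N > 3 * m * l / r" using reals_Archimedean2 by blast
  show "\<exists>N. \<forall>n\<ge>N. norm (ln (card (G n)) / n - 0) < r"
  proof (intro exI allI impI)
    fix n assume n: "n \<ge> Suc N"
    have "m * l < r / 3 * n"
    proof -
      have "3 * m * l / r < n" using N n by linarith
      then show ?thesis using r by (simp add: field_simps)
    qed
    have "ln (card (G n)) < r * n"
    proof (cases "card (G n) = 0")
      case True
      then show ?thesis using r n by simp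
    next
      case False
      have "card (G n) * t powr (c * n + m) \<le> (1 + t) ^ n"
        using t sub m by (intro card_small_subsets_le) auto
      then have "ln (card (G n) * t powr (c * n + m)) \<le> ln ((1 + t) ^ n)"
        using False t by (subst ln_le_cancel_iff) auto
      then have "ln (card (G n)) - (c * n + m) * l \<le> n * ln (1 + t)"
        using False t by (simp add: ln_mult ln_powr ln_realpow l_def)
      also have "\<dots> \<le> n * t"
        using t by (intro mult_left_mono ln_add_one_self_le_self) auto
      also have "\<dots> \<le> n * (r / 3)"
        using t by (intro mult_left_mono) auto
      finally have "ln (card (G n)) \<le> n * (r / 3) + n * (c * l) + m * l"
        by (simp add: algebra_simps)
      then show ?thesis using \<open>m * l < r / 3 * n\<close> c by (simp add: field_simps)
    qed
    moreover have "ln (card (G n)) \<ge> 0"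
      by (cases "card (G n) = 0") auto
    ultimately show "norm (ln (card (G n)) / n - 0) < r"
      using n by (simp add: field_simps)
  qed
qed

section \<open>Itineraries of ideals\<close>

context cring
begin

text \<open>Only finitely many generators enter the construction of one element. This later trades
  finite generation over the scalars for finite generation over the integers.\<close>

lemma generate_ring_finite_support:
  assumes "H \<subseteq> carrier R" and "h \<in> generate_ring R H"
  shows "\<exists>H'. finite H' \<and> H' \<subseteq> H \<and> h \<in> generate_ring R H'"
  using assms(2)
proof induction
  case one
  show ?case by (intro exI[of _ "{}"]) (simp add: generate_ring.one)
next
  case (incl h)
  then show ?case by (intro exI[of _ "{h}"]) (simp add: generate_ring.incl)
next
  case (a_inv h)
  then show ?case using generate_ring.a_inv by metis
next
  case (eng_add h1 h2)
  then obtain H1 H2 where H: "finite H1" "H1 \<subseteq> H" "h1 \<in> generate_ring R H1"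
    "finite H2" "H2 \<subseteq> H" "h2 \<in> generate_ring R H2" by blast
  have "generate_ring R H1 \<subseteq> generate_ring R (H1 \<union> H2)" "generate_ring R H2 \<subseteq> generate_ring R (H1 \<union> H2)"
    by - (rule mono_generate_ring; use H assms(1) in blast)+
  then show ?case
    using H by (intro exI[of _ "H1 \<union> H2"]) (auto intro!: generate_ring.eng_add)
next
  case (eng_mult h1 h2)
  then obtain H1 H2 where H: "finite H1" "H1 \<subseteq> H" "h1 \<in> generate_ring R H1"
    "finite H2" "H2 \<subseteq> H" "h2 \<in> generate_ring R H2" by blast
  have "generate_ring R H1 \<subseteq> generate_ring R (H1 \<union> H2)" "generate_ring R H2 \<subseteq> generate_ring R (H1 \<union> H2)"
    by - (rule mono_generate_ring; use H assms(1) in blast)+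
  then show ?case
    using H by (intro exI[of _ "H1 \<union> H2"]) (auto intro!: generate_ring.eng_mult)
qed

lemma ring_hom_minus:
  assumes "F \<in> ring_hom R R" "h \<in> carrier R"
  shows "F (\<ominus> h) = \<ominus> F h"
proof (rule minus_equality[symmetric])
  have "F (\<ominus> h) \<oplus> F h = F (\<ominus> h \<oplus> h)"
    using assms by (simp add: ring_hom_add)
  also have "\<dots> = \<zero>"
    using assms ring_hom_zero[OF assms(1) ring_axioms ring_axioms] by (simp add: l_neg)
  finally show "F (\<ominus> h) \<oplus> F h = \<zero>" .
qed (use assms ring_hom_closed[OF assms(1)] in auto)

text \<open>To \<open>S\<close> are added the finitely many generators that express \<open>a\<close>
  and the images under \<open>F\<close> of the elements of \<open>S\<close>. Those outside
  \<open>S\<close> are scalars fixed by \<open>F\<close>, so every generator is mapped back into the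
  subring.\<close>

lemma invariant_finitely_generated_subring:
  assumes "finite S" and CS: "C \<union> S \<subseteq> carrier R" and gen: "generate_ring R (C \<union> S) = carrier R"
    and F: "F \<in> ring_hom R R" and fix_C: "\<And>c. c \<in> C \<Longrightarrow> F c = c" and a: "a \<in> carrier R"
  shows "\<exists>H. finite H \<and> H \<subseteq> carrier R \<and> a \<in> generate_ring R H \<and>
    F ` generate_ring R H \<subseteq> generate_ring R H"
proof -
  have "insert a (F ` S) \<subseteq> carrier R"
    using CS a ring_hom_closed[OF F] by auto
  then have "\<forall>e\<in>insert a (F ` S). \<exists>H. finite H \<and> H \<subseteq> C \<union> S \<and> e \<in> generate_ring R H"
    using generate_ring_finite_support[OF CS] gen by blast
  then obtain G where G: "\<And>e. e \<in> insert a (F ` S) \<Longrightarrow> finite (G e) \<and> G e \<subseteq> C \<union> S \<and> e \<in> generate_ring R (G e)"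
    by metis
  define H where "H = S \<union> (\<Union>e\<in>insert a (F ` S). G e)"
  have H: "finite H" "H \<subseteq> C \<union> S"
    using G \<open>finite S\<close> unfolding H_def by auto
  then have HR: "H \<subseteq> carrier R" using CS by blast
  have G_H: "e \<in> generate_ring R H" if "e \<in> insert a (F ` S)" for e
  proof -
    have "generate_ring R (G e) \<subseteq> generate_ring R H"
      using that H CS by (intro mono_generate_ring) (auto simp: H_def)
    then show ?thesis using G[OF that] by blast
  qed
  have "F h \<in> generate_ring R H" if "h \<in> generate_ring R H" for h
    using that
  proof induction
    case one
    then show ?case using ring_hom_one[OF F] by (simp add: generate_ring.one)
  next
    case (incl h)
    show ?case
    proof (cases "h \<in> S")
      case True
      then show ?thesis using G_H by blast
    next
      case False
      then have "F h = h" using incl H(2) fix_C by blast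
      then show ?thesis using incl by (simp add: generate_ring.incl)
    qed
  next
    case (a_inv h)
    then show ?case
      using generate_ring_in_carrier[OF HR] ring_hom_minus[OF F] by (auto intro: generate_ring.a_inv)
  next
    case (eng_add h1 h2)
    then show ?case
      using generate_ring_in_carrier[OF HR] ring_hom_add[OF F] by (auto intro: generate_ring.eng_add)
  next
    case (eng_mult h1 h2)
    then show ?case
      using generate_ring_in_carrier[OF HR] ring_hom_mult[OF F] by (auto intro: generate_ring.eng_mult)
  qed
  then show ?thesis
    using H CS G_H by (intro exI[of _ H]) auto
qed

section \<open>Itineraries encoded by independent times\<close>

text \<open>The visiting times are encoded greedily by those whose term is independent of the
  earlier visited terms. The ideal of \<open>B\<close> generated by the encoded terms contains all
  visited terms and lies in \<open>I\<close>, so the encoding loses nothing.\<close>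

lemma ideal_itineraries_subexponential:
  assumes B: "subring B R" and acc: "acc_on R B" and F: "F \<in> ring_hom R R" and FB: "F ` B \<subseteq> B"
    and a: "a \<in> B" and S: "\<And>I. I \<in> S \<Longrightarrow> ideal I R"
  shows "(\<lambda>n. ln (card ((\<lambda>I. {j. j < n \<and> (F ^^ j) a \<in> I}) ` S)) / n) \<longlonglongrightarrow> 0"
proof -
  let ?B = "R\<lparr>carrier := B\<rparr>"
  note B_ring = subring_is_ring[OF B]
  note idealB = ideal_subring_iff[OF B]
  have orbit: "(F ^^ j) a \<in> B" for j
    by (induction j) (use a FB in auto)
  define D where "D Y = genideal ?B ((\<lambda>j. (F ^^ j) a) ` Y)" for Y
  have D_ideal: "ideal (D Y) ?B" for Y
    unfolding D_def using orbit by (intro ring.genideal_ideal[OF B_ring]) auto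
  have D_incl: "(F ^^ j) a \<in> D Y" if "j \<in> Y" for j Y
    unfolding D_def using orbit that ring.genideal_self[OF B_ring, of "(\<lambda>j. (F ^^ j) a) ` Y"] by auto
  have D_min: "D Y \<subseteq> I" if "ideal I ?B" "\<And>j. j \<in> Y \<Longrightarrow> (F ^^ j) a \<in> I" for Y I
    unfolding D_def using that by (intro ring.genideal_minimal[OF B_ring]) auto
  have D_mono: "D Y \<subseteq> D Z" if "Y \<subseteq> Z" for Y Z
    using that D_incl by (intro D_min D_ideal) auto
  define FF where "FF = {Y. \<forall>j\<in>Y. (F ^^ j) a \<notin> D (Y \<inter> {..<j})}"
  have FF_sub: "Z \<in> FF" if "Y \<in> FF" "Z \<subseteq> Y" for Y Z
    using that D_mono[of "Z \<inter> {..<j}" "Y \<inter> {..<j}" for j] unfolding FF_def by blast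
  have FF_shift: "Y \<in> FF" if Y: "Suc ` Y \<in> FF" for Y
  proof -
    have "(F ^^ j) a \<notin> D (Y \<inter> {..<j})" if j: "j \<in> Y" for j
    proof
      assume mem: "(F ^^ j) a \<in> D (Y \<inter> {..<j})"
      let ?E = "D (Suc ` Y \<inter> {..<Suc j})"
      note E = D_ideal[of "Suc ` Y \<inter> {..<Suc j}", unfolded idealB]
      have "ideal {b \<in> B. F b \<in> ?E} ?B"
        unfolding idealB
      proof (intro conjI ballI)
        show "\<zero> \<in> {b \<in> B. F b \<in> ?E}"
          using E subringE(2)[OF B] ring_hom_zero[OF F ring_axioms ring_axioms] by simp
        fix b assume b: "b \<in> {b \<in> B. F b \<in> ?E}"
        then have bR: "b \<in> carrier R" using subringE(1)[OF B] by blast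
        {
          fix c assume "c \<in> {b \<in> B. F b \<in> ?E}"
          moreover from this have "c \<in> carrier R" using subringE(1)[OF B] by blast
          ultimately show "b \<oplus> c \<in> {b \<in> B. F b \<in> ?E}"
            using b bR E subringE(7)[OF B] ring_hom_add[OF F] by auto
        }
        fix r assume "r \<in> B"
        moreover from this have "r \<in> carrier R" "F r \<in> B" using subringE(1)[OF B] FB by auto
        ultimately show "r \<otimes> b \<in> {b \<in> B. F b \<in> ?E}"
          using b bR E subringE(6)[OF B] ring_hom_mult[OF F] by auto
      qed blast
      then have "D (Y \<inter> {..<j}) \<subseteq> {b \<in> B. F b \<in> ?E}"
      proof (rule D_min)
        fix i assume "i \<in> Y \<inter> {..<j}"
        then have "Suc i \<in> Suc ` Y \<inter> {..<Suc j}" by simp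
        from D_incl[OF this] show "(F ^^ i) a \<in> {b \<in> B. F b \<in> ?E}"
          using orbit by simp
      qed
      then have "(F ^^ Suc j) a \<in> ?E" using mem by auto
      then show False using Y j unfolding FF_def by blast
    qed
    then show ?thesis unfolding FF_def by blast
  qed
  \<comment> \<open>Each element of an independent set enlarges the ideal of its prefix, so an
    infinite one would violate the ascending chain condition.\<close>
  have FF_noinf: "\<exists>k. J \<inter> {..<k} \<notin> FF" if "infinite J" for J
  proof (rule ccontr)
    assume "\<nexists>k. J \<inter> {..<k} \<notin> FF"
    then have J: "J \<inter> {..<k} \<in> FF" for k by blast
    have "mono (\<lambda>k. D (J \<inter> {..<k}))"
      by (intro monoI D_mono) auto
    then obtain N where N: "\<And>k. k \<ge> N \<Longrightarrow> D (J \<inter> {..<k}) = D (J \<inter> {..<N})"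
      using acc D_ideal unfolding acc_on_def by meson
    obtain j where j: "j \<ge> N" "j \<in> J"
      using \<open>infinite J\<close> infinite_nat_iff_unbounded_le by blast
    have "J \<inter> {..<Suc j} \<inter> {..<j} = J \<inter> {..<j}" by auto
    moreover have "(F ^^ j) a \<notin> D (J \<inter> {..<Suc j} \<inter> {..<j})"
      using J[of "Suc j"] j unfolding FF_def by blast
    ultimately have "(F ^^ j) a \<notin> D (J \<inter> {..<j})"
      by simp
    moreover have "D (J \<inter> {..<Suc j}) = D (J \<inter> {..<j})"
      using N[of j] N[of "Suc j"] j by simp
    moreover have "(F ^^ j) a \<in> D (J \<inter> {..<Suc j})"
      using j by (intro D_incl) auto
    ultimately show False by simp
  qed
  define G where "G n = {Y \<in> FF. Y \<subseteq> {..<n}}" for n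
  define Q where "Q n = (\<lambda>I. {j. j < n \<and> (F ^^ j) a \<in> I}) ` S" for n
  have finG: "finite (G n)" for n
    by (rule finite_subset[of _ "Pow {..<n}"]) (auto simp: G_def)
  have "Q n \<subseteq> (\<lambda>Y. {j. j < n \<and> (F ^^ j) a \<in> D Y}) ` G n" for n
  proof
    fix W assume "W \<in> Q n"
    then obtain I where I: "I \<in> S" and W: "W = {j. j < n \<and> (F ^^ j) a \<in> I}"
      unfolding Q_def by blast
    \<comment> \<open>Independence is tested against all earlier times in \<open>W\<close>. Since
      \<open>D\<close> is monotone, this implies independence within \<open>Y\<close>, hence
      \<open>Y \<in> FF\<close>.\<close>
    define Y where "Y = {j \<in> W. (F ^^ j) a \<notin> D (W \<inter> {..<j})}"
    have "Y \<subseteq> W" by (auto simp: Y_def)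
    then have "Y \<in> G n"
      using D_mono[of "Y \<inter> {..<j}" "W \<inter> {..<j}" for j] unfolding G_def FF_def by (auto simp: Y_def W)
    have IB: "ideal (I \<inter> B) ?B"
      unfolding idealB using S[OF I] ideal_subring_iff[OF carrier_is_subring, of I] subringE[OF B] by auto
    have "D Y \<subseteq> I \<inter> B"
      using orbit \<open>Y \<subseteq> W\<close> W by (intro D_min IB) auto
    \<comment> \<open>Omitted times are recovered by strong induction: their terms depend on earlier
      visited terms, which already lie in \<open>D Y\<close>.\<close>
    moreover have "(F ^^ j) a \<in> D Y" if "j \<in> W" for j
      using that
    proof (induction j rule: less_induct)
      case (less j)
      show ?case
      proof (cases "j \<in> Y")
        case True
        then show ?thesis by (rule D_incl)
      next
        case False
        then have "(F ^^ j) a \<in> D (W \<inter> {..<j})"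
          using less.prems by (simp add: Y_def)
        moreover have "D (W \<inter> {..<j}) \<subseteq> D Y"
          using less.IH by (intro D_min D_ideal) auto
        ultimately show ?thesis by blast
      qed
    qed
    ultimately have "W = {j. j < n \<and> (F ^^ j) a \<in> D Y}"
      unfolding W by blast
    then show "W \<in> (\<lambda>Y. {j. j < n \<and> (F ^^ j) a \<in> D Y}) ` G n"
      using \<open>Y \<in> G n\<close> by blast
  qed
  then have card: "card (Q n) \<le> card (G n)" for n
    by (rule surj_card_le[OF finG])
  have "(\<lambda>n. ln (card (G n)) / n) \<longlonglongrightarrow> 0"
  proof (rule subexponential_if_sparse)
    show "Y \<subseteq> {..<n}" if "Y \<in> G n" for n Y
      using that by (simp add: G_def)
    fix c :: real assume "c > 0"
    have "\<exists>m::nat. \<forall>n. \<forall>Y\<in>FF. Y \<subseteq> {..<n} \<longrightarrow> card Y \<le> c * n + m"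
    proof (rule sparse_if_no_infinite)
      show "Z \<in> FF" if "Y \<in> FF" "Z \<subseteq> Y" for Y Z
        using that by (rule FF_sub)
    qed (fact FF_shift FF_noinf \<open>c > 0\<close>)+
    then show "\<exists>m::nat. \<forall>n. \<forall>Y\<in>G n. card Y \<le> c * n + m"
      unfolding G_def by blast
  qed
  then have "(\<lambda>n. ln (card (Q n)) / n) \<longlonglongrightarrow> 0"
  proof (rule tendsto_sandwich[OF always_eventually always_eventually tendsto_const, rotated 2]; intro allI)
    fix n
    show "0 \<le> ln (card (Q n)) / n"
      by (cases "card (Q n) = 0") auto
    show "ln (card (Q n)) / n \<le> ln (card (G n)) / n"
    proof (cases "card (Q n) = 0")
      case True
      then show ?thesis by (cases "card (G n) = 0") auto
    next
      case False
      then show ?thesis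
        using card[of n] by (intro divide_right_mono) auto
    qed
  qed
  then show ?thesis unfolding Q_def .
qed

end

section \<open>Entropy and the constructible topology\<close>

lemma min_subcover_le:
  assumes "V \<subseteq> U" "finite V" "topspace T \<subseteq> \<Union>V"
  shows "min_subcover T U \<le> card V"
  unfolding min_subcover_def using assms by (intro Least_le) blast

text \<open>The case \<open>k = 0\<close> rests on the convention \<open>ln 0 = 0\<close>.\<close>

lemma ln_of_nat_nonneg: "0 \<le> ln (real k)"
  by (cases "k = 0") auto

lemma ln_of_nat_mono: "k \<le> l \<Longrightarrow> ln (real k) \<le> ln (real l)"
  using ln_of_nat_nonneg[of l] by (cases "k = 0") auto

text \<open>Points with equal traces on \<open>E\<close> along the first \<open>n\<close> iterates
  share a member of the iterated cover. Joint itineraries are tuples of the itineraries of single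
  elements, so minimal subcovers are bounded by a product over \<open>E\<close>; after taking
  logarithms each factor has growth rate zero.\<close>

lemma htop_eq_0I:
  fixes T :: "'a set topology"
  assumes T: "topspace T = S" and g: "g ` S \<subseteq> S"
    and sep: "\<And>U. open_fin_cover T U \<Longrightarrow>
      \<exists>E. finite E \<and> E \<subseteq> C \<and> (\<forall>I\<in>S. \<exists>u\<in>U. \<forall>I'\<in>S. I' \<inter> E = I \<inter> E \<longrightarrow> I' \<in> u)"
    and growth: "\<And>e. e \<in> C \<Longrightarrow>
      (\<lambda>n. ln (card ((\<lambda>I. {j. j < n \<and> e \<in> (g ^^ j) I}) ` S)) / n) \<longlonglongrightarrow> 0"
  shows "htop T g = 0"
proof -
  have orbit: "(g ^^ j) I \<in> S" if "I \<in> S" for j I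
    by (induction j) (use that g in auto)
  have "(\<lambda>n. ln (min_subcover T (iter_join T g U n)) / n) \<longlonglongrightarrow> 0" if U: "open_fin_cover T U" for U
  proof -
    obtain E where E: "finite E" "E \<subseteq> C"
      and cover: "\<forall>I\<in>S. \<exists>u\<in>U. \<forall>I'\<in>S. I' \<inter> E = I \<inter> E \<longrightarrow> I' \<in> u"
      using sep[OF U] by auto
    from cover obtain w where w: "\<And>I. I \<in> S \<Longrightarrow> w I \<in> U"
      "\<And>I I'. I \<in> S \<Longrightarrow> I' \<in> S \<Longrightarrow> I' \<inter> E = I \<inter> E \<Longrightarrow> I' \<in> w I"
      by metis
    define it where "it n e I = {j. j < n \<and> e \<in> (g ^^ j) I}" for n e I
    have cell: "\<exists>V\<in>iter_join T g U n. \<forall>I'\<in>S. (\<forall>j<n. (g ^^ j) I' \<inter> E = (g ^^ j) I \<inter> E) \<longrightarrow> I' \<in> V"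
      if "I \<in> S" for I n
    proof (induction n)
      case 0
      then show ?case using T by simp
    next
      case (Suc n)
      then obtain V where V: "V \<in> iter_join T g U n"
        "\<forall>I'\<in>S. (\<forall>j<n. (g ^^ j) I' \<inter> E = (g ^^ j) I \<inter> E) \<longrightarrow> I' \<in> V" by blast
      let ?V = "V \<inter> (topspace T \<inter> (g ^^ n) -` w ((g ^^ n) I))"
      have "?V \<in> iter_join T g U (Suc n)"
        using V(1) w(1)[OF orbit[OF that]] by (auto simp: join_cover_def preim_cover_def)
      moreover have "I' \<in> ?V" if I': "I' \<in> S" "\<forall>j<Suc n. (g ^^ j) I' \<inter> E = (g ^^ j) I \<inter> E" for I'
        using I' V(2) T w(2)[OF orbit[OF \<open>I \<in> S\<close>] orbit[OF I'(1)], of n n] by auto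
      ultimately show ?case by blast
    qed
    have le: "min_subcover T (iter_join T g U n) \<le> (\<Prod>e\<in>E. card (it n e ` S))" for n
    proof -
      have "\<forall>I\<in>S. \<exists>V. V \<in> iter_join T g U n \<and>
          (\<forall>I'\<in>S. (\<forall>j<n. (g ^^ j) I' \<inter> E = (g ^^ j) I \<inter> E) \<longrightarrow> I' \<in> V)"
        using cell by blast
      from bchoice[OF this] obtain V where V: "\<And>I. I \<in> S \<Longrightarrow> V I \<in> iter_join T g U n"
        "\<And>I I'. I \<in> S \<Longrightarrow> I' \<in> S \<Longrightarrow> \<forall>j<n. (g ^^ j) I' \<inter> E = (g ^^ j) I \<inter> E \<Longrightarrow> I' \<in> V I"
        by blast
      \<comment> \<open>With \<open>restrict\<close> the joint itinerary becomes an element of a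
        \<open>PiE\<close> set, whose cardinality is the product. One representative
        \<open>rep\<close> per pattern then makes the subcover count patterns instead of
        points.\<close>
      define pat where "pat I = restrict (\<lambda>e. it n e I) E" for I
      define rep where "rep p = (SOME I. I \<in> S \<and> pat I = p)" for p
      have rep: "rep (pat I) \<in> S \<and> pat (rep (pat I)) = pat I" if "I \<in> S" for I
        unfolding rep_def by (rule someI_ex) (use that in auto)
      have fin: "finite (it n e ` S)" for e
        by (rule finite_subset[of _ "Pow {..<n}"]) (auto simp: it_def)
      have pat_sub: "pat ` S \<subseteq> PiE E (\<lambda>e. it n e ` S)"
        by (auto simp: pat_def)
      have fin_PiE: "finite (PiE E (\<lambda>e. it n e ` S))"
        using E fin by (intro finite_PiE) auto
      have fin_pat: "finite (pat ` S)"
        using pat_sub fin_PiE finite_subset by blast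
      have "min_subcover T (iter_join T g U n) \<le> card ((\<lambda>p. V (rep p)) ` pat ` S)"
      proof (rule min_subcover_le)
        show "(\<lambda>p. V (rep p)) ` pat ` S \<subseteq> iter_join T g U n"
          using V(1) rep by auto
        show "topspace T \<subseteq> \<Union> ((\<lambda>p. V (rep p)) ` pat ` S)"
        proof
          fix I assume "I \<in> topspace T"
          then have I: "I \<in> S" using T by simp
          have eq: "it n e (rep (pat I)) = it n e I" if "e \<in> E" for e
            using rep[OF I] that unfolding pat_def by (metis restrict_apply')
          have "(g ^^ j) I \<inter> E = (g ^^ j) (rep (pat I)) \<inter> E" if "j < n" for j
            using eq that unfolding it_def by blast
          then have "I \<in> V (rep (pat I))"
            using V(2) rep[OF I] I by blast
          then show "I \<in> \<Union> ((\<lambda>p. V (rep p)) ` pat ` S)"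
            using I by blast
        qed
      qed (use fin_pat in simp)
      also have "\<dots> \<le> card (pat ` S)"
        using fin_pat by (rule card_image_le)
      also have "\<dots> \<le> card (PiE E (\<lambda>e. it n e ` S))"
        by (rule card_mono[OF fin_PiE pat_sub])
      also have "\<dots> = (\<Prod>e\<in>E. card (it n e ` S))"
        by (rule card_PiE[OF E(1)])
      finally show ?thesis .
    qed
    have "(\<lambda>n. \<Sum>e\<in>E. ln (card (it n e ` S)) / n) \<longlonglongrightarrow> (\<Sum>e\<in>E. 0)"
      unfolding it_def using E growth by (intro tendsto_sum) blast
    then have lim0: "(\<lambda>n. \<Sum>e\<in>E. ln (card (it n e ` S)) / n) \<longlonglongrightarrow> 0"
      by simp
    show ?thesis
    proof (rule tendsto_sandwich[OF always_eventually always_eventually tendsto_const lim0]; intro allI)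
      fix n
      show "0 \<le> ln (min_subcover T (iter_join T g U n)) / n"
        by (simp add: ln_of_nat_nonneg)
      have "ln (min_subcover T (iter_join T g U n)) \<le> ln (\<Prod>e\<in>E. card (it n e ` S))"
        using le ln_of_nat_mono by blast
      also have "\<dots> \<le> (\<Sum>e\<in>E. ln (card (it n e ` S)))"
      \<comment> \<open>The product vanishes only if \<open>S\<close> is empty; its logarithm is
        then zero by convention.\<close>
      proof (cases "(\<Prod>e\<in>E. card (it n e ` S)) = 0")
        case True
        then show ?thesis unfolding True by (simp add: sum_nonneg ln_of_nat_nonneg)
      next
        case False
        then show ?thesis
          using E(1) by (subst of_nat_prod, subst ln_prod) (auto intro: Nat.gr0I)
      qed
      finally have "ln (min_subcover T (iter_join T g U n)) / n \<le> (\<Sum>e\<in>E. ln (card (it n e ` S))) / n"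
        by (intro divide_right_mono) auto
      then show "ln (min_subcover T (iter_join T g U n)) / n \<le> (\<Sum>e\<in>E. ln (card (it n e ` S)) / n)"
        by (simp add: sum_divide_distrib)
    qed
  qed
  then have "lim (\<lambda>n. ln (min_subcover T (iter_join T g U n)) / n) = 0" if "open_fin_cover T U" for U
    using that limI by blast
  \<comment> \<open>The trivial cover makes the index set nonempty; the supremum of an empty set in
    \<open>ereal\<close> would be minus infinity.\<close>
  moreover have "open_fin_cover T {topspace T}"
    by (simp add: open_fin_cover_def)
  ultimately have "(SUP U \<in> {U. open_fin_cover T U}.
      ereal (lim (\<lambda>n. ln (min_subcover T (iter_join T g U n)) / n))) = (SUP U \<in> {U. open_fin_cover T U}. 0)"
    by (intro SUP_cong) auto
  also have "\<dots> = 0"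
    using \<open>open_fin_cover T {topspace T}\<close> by (intro cSUP_const) blast
  finally show ?thesis
    unfolding htop_def .
qed

section \<open>Compactness of the constructible topology\<close>

text \<open>Coordinates range over the whole type; ideals are later cut out by closed conditions,
  one of which makes all coordinates outside the carrier false.\<close>

abbreviation cantor_top :: "('a \<Rightarrow> bool) topology" where
  "cantor_top \<equiv> product_topology (\<lambda>_. discrete_topology UNIV) UNIV"

lemma topspace_cantor_top: "topspace cantor_top = UNIV"
  by simp

lemma closedin_cantor_top_component:
  "closedin cantor_top {\<xi>. \<xi> a \<in> A}" and openin_cantor_top_component: "openin cantor_top {\<xi>. \<xi> a \<in> A}"
proof -
  have cont: "continuous_map cantor_top (discrete_topology UNIV) (\<lambda>\<xi>. \<xi> a)"
    by (rule continuous_map_product_projection) simp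
  show "closedin cantor_top {\<xi>. \<xi> a \<in> A}"
    using closedin_continuous_map_preimage[OF cont, of A] by simp
  show "openin cantor_top {\<xi>. \<xi> a \<in> A}"
    using openin_continuous_map_preimage[OF cont, of A] by simp
qed

lemma closedin_cantor_top_atom: "closedin cantor_top {\<xi>. \<xi> a}" "closedin cantor_top {\<xi>. \<not> \<xi> a}"
  using closedin_cantor_top_component[of a "{True}"] closedin_cantor_top_component[of a "{False}"] by simp_all

lemma closedin_Collect_const: "topspace T = UNIV \<Longrightarrow> closedin T {x. P}"
  using closedin_topspace[of T] by (cases P) auto

lemma closedin_Collect_all: "topspace T = UNIV \<Longrightarrow> (\<And>a. closedin T {x. P a x}) \<Longrightarrow> closedin T {x. \<forall>a. P a x}"
  using closedin_Inter[of "range (\<lambda>a. {x. P a x})" T] by (auto simp: INT_simps Collect_all_eq)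

lemma closedin_Collect_conj: "closedin T {x. P x} \<Longrightarrow> closedin T {x. A x} \<Longrightarrow> closedin T {x. P x \<and> A x}"
  using closedin_Int[of T "{x. P x}" "{x. A x}"] by (simp add: Collect_conj_eq)

lemma closedin_Collect_disj: "closedin T {x. P x} \<Longrightarrow> closedin T {x. A x} \<Longrightarrow> closedin T {x. P x \<or> A x}"
  using closedin_Un[of T "{x. P x}" "{x. A x}"] by (simp add: Collect_disj_eq)

text \<open>Each literal in one coordinate is a closed condition, and so is whatever conjunction,
  disjunction and universal quantification build from literals. Closedness can thus be read off from
  the syntax of a formula.\<close>

lemmas closedin_cantor_top_intros = closedin_cantor_top_atom closedin_Collect_const[OF topspace_cantor_top]
  closedin_Collect_all[OF topspace_cantor_top] closedin_Collect_conj closedin_Collect_disj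

context cring
begin

text \<open>The axioms are written with unbounded quantifiers and disjunctions of literals to match
  \<open>closedin_cantor_top_intros\<close>; properness becomes the single literal
  \<open>\<one> \<notin> I\<close>.\<close>

lemma Id_set_iff:
  "I \<in> Id_set R \<longleftrightarrow> (\<forall>a. a \<in> carrier R \<or> a \<notin> I) \<and> \<zero> \<in> I \<and> \<one> \<notin> I \<and>
    (\<forall>a b. a \<notin> I \<or> b \<notin> I \<or> a \<oplus> b \<in> I) \<and> (\<forall>a r. r \<notin> carrier R \<or> a \<notin> I \<or> r \<otimes> a \<in> I)"
proof -
  have "ideal I R \<Longrightarrow> \<one> \<in> I \<Longrightarrow> I = carrier R"
    by (rule ideal.one_imp_carrier)
  moreover have "ideal I R \<longleftrightarrow> I \<subseteq> carrier R \<and> \<zero> \<in> I \<and> (\<forall>a\<in>I. \<forall>b\<in>I. a \<oplus> b \<in> I) \<and>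
      (\<forall>a\<in>I. \<forall>r\<in>carrier R. r \<otimes> a \<in> I)"
    using ideal_subring_iff[OF carrier_is_subring, of I] by simp
  ultimately show ?thesis
    unfolding Id_set_def by auto
qed

lemma Spec_iff:
  "I \<in> Spec R \<longleftrightarrow> I \<in> Id_set R \<and>
    (\<forall>a b. a \<notin> carrier R \<or> b \<notin> carrier R \<or> a \<otimes> b \<notin> I \<or> a \<in> I \<or> b \<in> I)"
  unfolding Spec_def Id_set_def primeideal_def primeideal_axioms_def
  using cring_axioms by auto

lemma closedin_cantor_top_Id_set: "closedin cantor_top {\<xi>. Collect \<xi> \<in> Id_set R}"
  unfolding Id_set_iff mem_Collect_eq by (intro closedin_cantor_top_intros)

lemma closedin_cantor_top_Spec: "closedin cantor_top {\<xi>. Collect \<xi> \<in> Spec R}"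
  unfolding Spec_iff mem_Collect_eq by (intro closedin_cantor_top_intros closedin_cantor_top_Id_set)

context
  fixes S :: "'a set set"
  assumes S: "S \<subseteq> Id_set R"
begin

text \<open>The space of a generated topology is the union of its generators. Properness puts all of
  \<open>S\<close> into the generator belonging to \<open>\<one>\<close>.\<close>

lemma topspace_zariski_top: "topspace (zariski_top R S) = S"
proof -
  have "{I \<in> S. \<one> \<notin> I} = S"
    using S by (auto simp: Id_set_iff)
  then have "S \<subseteq> \<Union> {{I \<in> S. a \<notin> I} | a. a \<in> carrier R}"
    by blast
  then show ?thesis
    unfolding zariski_top_def topology_generated_by_topspace by blast
qed

lemma topspace_constructible_top: "topspace (constructible_top R S) = S"
  using topspace_zariski_top
  unfolding zariski_top_def constructible_top_def topology_generated_by_topspace by blast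

lemma openin_constructible_top_cylinder:
  assumes "finite E" "E \<subseteq> carrier R"
  shows "openin (constructible_top R S) {I' \<in> S. I' \<inter> E = I \<inter> E}"
  using assms
proof (induction E)
  case empty
  then show ?case
    using openin_topspace[of "constructible_top R S"] topspace_constructible_top by simp
next
  case (insert e E)
  have "openin (constructible_top R S) {I' \<in> S. e \<in> I' \<longleftrightarrow> e \<in> I}"
    using insert.prems unfolding constructible_top_def
    by (cases "e \<in> I") (auto intro!: topology_generated_by_Basis)
  then have "openin (constructible_top R S) ({I' \<in> S. e \<in> I' \<longleftrightarrow> e \<in> I} \<inter> {I' \<in> S. I' \<inter> E = I \<inter> E})"
    using insert by (intro openin_Int) auto
  moreover have "{I' \<in> S. I' \<inter> insert e E = I \<inter> insert e E} =
      {I' \<in> S. e \<in> I' \<longleftrightarrow> e \<in> I} \<inter> {I' \<in> S. I' \<inter> E = I \<inter> E}"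
    using insert.hyps by auto
  ultimately show ?case by simp
qed

text \<open>An open set is built from generators that test one element each, through finite
  intersections and arbitrary unions, so finitely many tests already certify that a point belongs to
  it.\<close>

lemma openin_constructible_topD:
  assumes "openin (constructible_top R S) u" "I \<in> u"
  shows "\<exists>E. finite E \<and> E \<subseteq> carrier R \<and> (\<forall>I'\<in>S. I' \<inter> E = I \<inter> E \<longrightarrow> I' \<in> u)"
proof -
  have "generate_topology_on ({{I \<in> S. a \<in> I} | a. a \<in> carrier R} \<union> {{I \<in> S. a \<notin> I} | a. a \<in> carrier R}) u"
    using assms(1) unfolding constructible_top_def openin_topology_generated_by_iff .
  then show ?thesis using assms(2)
  proof induction
    case (Int u v)
    then obtain E E' where E: "finite E" "E \<subseteq> carrier R" "\<forall>I'\<in>S. I' \<inter> E = I \<inter> E \<longrightarrow> I' \<in> u"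
      "finite E'" "E' \<subseteq> carrier R" "\<forall>I'\<in>S. I' \<inter> E' = I \<inter> E' \<longrightarrow> I' \<in> v" by auto
    have "I' \<in> u \<inter> v" if "I' \<in> S" "I' \<inter> (E \<union> E') = I \<inter> (E \<union> E')" for I'
    proof -
      have "I' \<inter> E = I \<inter> E" "I' \<inter> E' = I \<inter> E'"
        using that(2) by blast+
      then show ?thesis using E that(1) by simp
    qed
    then show ?case
      using E by (intro exI[of _ "E \<union> E'"]) simp
  next
    case (UN K)
    then show ?case by (meson UnionE UnionI)
  next
    case (Basis s)
    then obtain a where "a \<in> carrier R" "s = {I \<in> S. a \<in> I} \<or> s = {I \<in> S. a \<notin> I}" by blast
    then show ?case
      using Basis.prems by (intro exI[of _ "{a}"]) auto
  qed simp
qed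

text \<open>By Tychonoff the space of characteristic functions is compact, and a closed part of it
  is mapped continuously onto \<open>S\<close> by \<open>Collect\<close>.\<close>

lemma compact_space_constructible_top:
  assumes "closedin cantor_top {\<xi>. Collect \<xi> \<in> S}"
  shows "compact_space (constructible_top R S)"
proof -
  let ?K = "{\<xi>. Collect \<xi> \<in> S}"
  have "compact_space (cantor_top :: ('a \<Rightarrow> bool) topology)"
    by (simp add: compact_space_product_topology compact_space_discrete_topology)
  then have K: "compactin cantor_top ?K"
    using assms closedin_compact_space by blast
  have "continuous_map (subtopology cantor_top ?K) (constructible_top R S) Collect"
    unfolding constructible_top_def
  proof (rule continuous_on_generated_topo)
    fix U assume "U \<in> {{I \<in> S. a \<in> I} | a. a \<in> carrier R} \<union> {{I \<in> S. a \<notin> I} | a. a \<in> carrier R}"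
    \<comment> \<open>Writing the two kinds of generators with a set of truth values lets one
      preimage computation serve both.\<close>
    then obtain a where "U = {I \<in> S. (a \<in> I) \<in> {True}} \<or> U = {I \<in> S. (a \<in> I) \<in> {False}}"
      by auto
    then obtain A where U: "U = {I \<in> S. (a \<in> I) \<in> A}"
      by blast
    have "Collect -` U \<inter> topspace (subtopology cantor_top ?K) = {\<xi>. \<xi> a \<in> A} \<inter> ?K"
      unfolding U by auto
    then show "openin (subtopology cantor_top ?K) (Collect -` U \<inter> topspace (subtopology cantor_top ?K))"
      using openin_cantor_top_component[of a A] by (auto simp: openin_subtopology)
  next
    show "Collect ` topspace (subtopology cantor_top ?K) \<subseteq>
        \<Union> ({{I \<in> S. a \<in> I} | a. a \<in> carrier R} \<union> {{I \<in> S. a \<notin> I} | a. a \<in> carrier R})"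
      using topspace_constructible_top unfolding constructible_top_def by auto
  qed
  then have "compactin (constructible_top R S) (Collect ` ?K)"
    using K by (intro image_compactin[of "subtopology cantor_top ?K"]) (auto simp: compactin_subtopology)
  moreover have "Collect ` ?K = S"
  proof
    show "S \<subseteq> Collect ` ?K"
    proof
      fix I assume "I \<in> S"
      then show "I \<in> Collect ` ?K"
        by (intro image_eqI[of _ _ "\<lambda>a. a \<in> I"]) simp_all
    qed
  qed blast
  ultimately show ?thesis
    by (simp add: compact_space_def topspace_constructible_top)
qed

text \<open>Around each ideal choose a cylinder inside a member of the cover. Finitely many
  cylinders suffice by compactness, and the union of their test sets refines all of them.\<close>

lemma open_fin_cover_separated:
  assumes closed: "closedin cantor_top {\<xi>. Collect \<xi> \<in> S}"
    and U: "open_fin_cover (constructible_top R S) U"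
  shows "\<exists>E. finite E \<and> E \<subseteq> carrier R \<and> (\<forall>I\<in>S. \<exists>u\<in>U. \<forall>I'\<in>S. I' \<inter> E = I \<inter> E \<longrightarrow> I' \<in> u)"
proof -
  have "\<exists>E u. finite E \<and> E \<subseteq> carrier R \<and> u \<in> U \<and> (\<forall>I'\<in>S. I' \<inter> E = I \<inter> E \<longrightarrow> I' \<in> u)" if I: "I \<in> S" for I
  proof -
    obtain u where u: "u \<in> U" "I \<in> u" "openin (constructible_top R S) u"
      using U I unfolding open_fin_cover_def topspace_constructible_top by blast
    from openin_constructible_topD[OF u(3,2)] u(1) show ?thesis by blast
  qed
  then obtain E w where E: "\<And>I. I \<in> S \<Longrightarrow> finite (E I) \<and> E I \<subseteq> carrier R"
    and w: "\<And>I. I \<in> S \<Longrightarrow> w I \<in> U \<and> (\<forall>I'\<in>S. I' \<inter> E I = I \<inter> E I \<longrightarrow> I' \<in> w I)"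
    by metis
  define N where "N I = {I' \<in> S. I' \<inter> E I = I \<inter> E I}" for I
  have "\<exists>\<F>. finite \<F> \<and> \<F> \<subseteq> N ` S \<and> topspace (constructible_top R S) \<subseteq> \<Union>\<F>"
  proof -
    have "\<forall>u\<in>N ` S. openin (constructible_top R S) u"
      unfolding N_def using E openin_constructible_top_cylinder by auto
    moreover have "topspace (constructible_top R S) \<subseteq> \<Union> (N ` S)"
      unfolding topspace_constructible_top N_def by auto
    ultimately show ?thesis
      using compact_space_constructible_top[OF closed] unfolding compact_space_alt by blast
  qed
  then obtain D where D: "finite D" "D \<subseteq> S" "S \<subseteq> \<Union> (N ` D)"
    unfolding topspace_constructible_top by (metis finite_subset_image)
  show ?thesis
  proof (intro exI[of _ "\<Union> (E ` D)"] conjI ballI)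
    show "finite (\<Union> (E ` D))" "\<Union> (E ` D) \<subseteq> carrier R"
      using D E by auto
    fix I assume I: "I \<in> S"
    then obtain J where J: "J \<in> D" "I \<inter> E J = J \<inter> E J"
      using D unfolding N_def by blast
    have "I' \<in> w J" if "I' \<in> S" "I' \<inter> \<Union> (E ` D) = I \<inter> \<Union> (E ` D)" for I'
    proof -
      have "I' \<inter> E J = J \<inter> E J"
        using that(2) J by blast
      then show ?thesis using w J(1) D(2) that(1) by blast
    qed
    then show "\<exists>u\<in>U. \<forall>I'\<in>S. I' \<inter> \<Union> (E ` D) = I \<inter> \<Union> (E ` D) \<longrightarrow> I' \<in> u"
      using w J(1) D(2) by blast
  qed
qed

text \<open>The constructible topology is finer, so the test sets found for its covers serve Zariski
  covers as well.\<close>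

lemma open_fin_cover_zariski_top:
  assumes "open_fin_cover (zariski_top R S) U"
  shows "open_fin_cover (constructible_top R S) U"
proof -
  have "openin (constructible_top R S) u" if "openin (zariski_top R S) u" for u
  proof -
    have "generate_topology_on {{I \<in> S. a \<notin> I} | a. a \<in> carrier R} u"
      using that unfolding zariski_top_def openin_topology_generated_by_iff .
    then show ?thesis
    proof induction
      case (UN K)
      then show ?case by (intro openin_Union) auto
    next
      case (Basis s)
      then show ?case unfolding constructible_top_def by (intro topology_generated_by_Basis) blast
    qed auto
  qed
  then show ?thesis
    using assms unfolding open_fin_cover_def topspace_zariski_top topspace_constructible_top by blast
qed

end

section \<open>The map induced on ideals\<close>

text \<open>This moves the dynamics from ideals to elements: itineraries of an ideal under taking
  preimages become visits of the \<open>F\<close>-orbit of \<open>a\<close> to a fixed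
  ideal.\<close>

lemma preimage_funpow:
  assumes F: "F \<in> ring_hom R R" and "I \<subseteq> carrier R" and a: "a \<in> carrier R"
  shows "a \<in> ((\<lambda>I. carrier R \<inter> F -` I) ^^ j) I \<longleftrightarrow> (F ^^ j) a \<in> I"
  using a
proof (induction j arbitrary: a)
  case (Suc j)
  then show ?case
    using ring_hom_closed[OF F] by (simp add: funpow_swap1)
qed simp

lemma preimage_Id_set:
  assumes F: "F \<in> ring_hom R R" and I: "I \<in> Id_set R"
  shows "carrier R \<inter> F -` I \<in> Id_set R"
  using I ring_hom_zero[OF F ring_axioms ring_axioms]
  by (auto simp: Id_set_iff ring_hom_one[OF F] ring_hom_add[OF F] ring_hom_mult[OF F] ring_hom_closed[OF F])

lemma preimage_Spec:
  assumes F: "F \<in> ring_hom R R" and I: "I \<in> Spec R"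
  shows "carrier R \<inter> F -` I \<in> Spec R"
  unfolding Spec_iff
proof (intro conjI allI)
  show "carrier R \<inter> F -` I \<in> Id_set R"
    using I preimage_Id_set[OF F] by (simp add: Spec_iff)
  fix a b
  have "F a \<in> I \<or> F b \<in> I" if "a \<in> carrier R" "b \<in> carrier R" "F (a \<otimes> b) \<in> I"
    using that I ring_hom_mult[OF F] ring_hom_closed[OF F] by (simp add: Spec_iff)
  then show "a \<notin> carrier R \<or> b \<notin> carrier R \<or> a \<otimes> b \<notin> carrier R \<inter> F -` I \<or>
      a \<in> carrier R \<inter> F -` I \<or> b \<in> carrier R \<inter> F -` I"
    by auto
qed

text \<open>Working with any closed invariant family of proper ideals handles \<open>Id_set\<close>
  and \<open>Spec\<close> together. The growth estimate is the same for both topologies; only the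
  source of the test sets differs.\<close>

lemma htop_preimage_eq_0:
  assumes "finite G" and CG: "C \<union> G \<subseteq> carrier R" and gen: "generate_ring R (C \<union> G) = carrier R"
    and F: "F \<in> ring_hom R R" and fix_C: "\<And>c. c \<in> C \<Longrightarrow> F c = c"
    and S: "S \<subseteq> Id_set R" and closed: "closedin cantor_top {\<xi>. Collect \<xi> \<in> S}"
    and inv: "(\<lambda>I. carrier R \<inter> F -` I) ` S \<subseteq> S"
  shows "htop (constructible_top R S) (\<lambda>I. carrier R \<inter> F -` I) = 0"
    and "htop (zariski_top R S) (\<lambda>I. carrier R \<inter> F -` I) = 0"
proof -
  let ?f = "\<lambda>I. carrier R \<inter> F -` I"
  have growth: "(\<lambda>n. ln (card ((\<lambda>I. {j. j < n \<and> e \<in> (?f ^^ j) I}) ` S)) / n) \<longlonglongrightarrow> 0"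
    if e: "e \<in> carrier R" for e
  proof -
    obtain H where H: "finite H" "H \<subseteq> carrier R" "e \<in> generate_ring R H"
      "F ` generate_ring R H \<subseteq> generate_ring R H"
      using invariant_finitely_generated_subring[OF \<open>finite G\<close> CG gen F fix_C e] by blast
    have eq: "(\<lambda>I. {j. j < n \<and> e \<in> (?f ^^ j) I}) ` S = (\<lambda>I. {j. j < n \<and> (F ^^ j) e \<in> I}) ` S" for n
    proof (rule image_cong[OF refl])
      fix I assume "I \<in> S"
      then have "I \<in> Id_set R"
        using S by blast
      then have "I \<subseteq> carrier R"
        by (auto simp: Id_set_iff)
      then show "{j. j < n \<and> e \<in> (?f ^^ j) I} = {j. j < n \<and> (F ^^ j) e \<in> I}"
        by (simp add: preimage_funpow[OF F _ e])
    qed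
    have "ideal I R" if "I \<in> S" for I
      using subsetD[OF S that] by (simp add: Id_set_def)
    then show ?thesis
      unfolding eq using H
      by (intro ideal_itineraries_subexponential[of "generate_ring R H"] generate_ring_is_subring
          acc_on_generate_ring F)
  qed
  show "htop (constructible_top R S) ?f = 0"
    by (rule htop_eq_0I[OF topspace_constructible_top[OF S] inv open_fin_cover_separated[OF S closed] growth])
  show "htop (zariski_top R S) ?f = 0"
    by (rule htop_eq_0I[OF topspace_zariski_top[OF S] inv
          open_fin_cover_separated[OF S closed open_fin_cover_zariski_top[OF S]] growth])
qed

end

theorem theorem4p2:
  fixes R :: "'r ring" and A :: "'a ring"
    and \<phi> :: "'r \<Rightarrow> 'a" and F :: "'a \<Rightarrow> 'a" and f :: "'a set \<Rightarrow> 'a set"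
  assumes "cring R" and "cring A"
    and "\<phi> \<in> ring_hom R A"
    and "\<exists>S. finite S \<and> S \<subseteq> carrier A \<and> generate_ring A (\<phi> ` carrier R \<union> S) = carrier A"
    and "F \<in> ring_hom A A"
    and "\<forall>r \<in> carrier R. F (\<phi> r) = \<phi> r"
    and "f = (\<lambda>I. carrier A \<inter> F -` I)"
  shows "htop (constructible_top A (Id_set A)) f = 0 \<and>
         htop (zariski_top A (Id_set A)) f = 0 \<and>
         htop (constructible_top A (Spec A)) f = 0 \<and>
         htop (zariski_top A (Spec A)) f = 0"
proof -
  interpret cring A by fact
  obtain G where G: "finite G" "G \<subseteq> carrier A" "generate_ring A (\<phi> ` carrier R \<union> G) = carrier A"
    using assms(4) by blast
  have CG: "\<phi> ` carrier R \<union> G \<subseteq> carrier A"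
    using G ring_hom_closed[OF assms(3)] by auto
  have fixed: "F c = c" if "c \<in> \<phi> ` carrier R" for c
    using that assms(6) by auto
  note zero = htop_preimage_eq_0[OF G(1) CG G(3) assms(5) fixed]
  have Id: "(\<lambda>I. carrier A \<inter> F -` I) ` Id_set A \<subseteq> Id_set A"
    using preimage_Id_set[OF assms(5)] by blast
  have Spec: "(\<lambda>I. carrier A \<inter> F -` I) ` Spec A \<subseteq> Spec A"
    using preimage_Spec[OF assms(5)] by blast
  have sub: "Spec A \<subseteq> Id_set A"
    using Spec_iff by blast
  show ?thesis
    unfolding assms(7)
    using zero[OF _ subset_refl closedin_cantor_top_Id_set Id] zero[OF _ sub closedin_cantor_top_Spec Spec]
    by blast
qed

end
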